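(* Let $\lambda=(\lambda_{31},\lambda_{32},\lambda_{33})$ be a highest weight of $sl_3$, $V_\lambda$ the corresponding irreducible representation with Gelfand--Tsetlin basis $(\xi_\Lambda)_{\Lambda\in\mathcal P_\lambda}$, and let $S=R^z_\chi R^y_\theta R^z_\phi\in SO(3)$ with real angles $\chi,\theta,\phi$. Let $\sigma$ be the operator on $V_\lambda$ representing $S^{-1}$, with matrix elements defined by $\sigma\,\xi_\Lambda=\sum_{\Lambda'\in\mathcal P_\lambda}\sigma_{\Lambda',\Lambda}\,\xi_{\Lambda'}$. Then for all $\Lambda=(\lambda_{11},\lambda_{21},\lambda_{22})$ and $\Lambda'=(\lambda'_{11},\lambda'_{21},\lambda'_{22})$ in $\mathcal P_\lambda$, $$\begin{aligned}\sigma_{\Lambda',\Lambda}=&\sum_{n=\max\{-\lambda_{21},-\lambda'_{21}\}}^{\min\{-\lambda_{22},-\lambda'_{22}\}}\ \sum_{\ell=\ell_{min}}^{\min\{\lambda_{31},\,n-\lambda_{33}\}}\mu_{\Lambda',\Lambda}(\ell,n)\; K_{n+\lambda'_{21}}\big(\lambda'_{11}-\lambda'_{22};\sin^2\phi,\lambda'_{21}-\lambda'_{22}\big)\\ &\times\widetilde R_{\lambda_{31}-\lambda'_{21}}\big(\lambda_{31}-\ell;\ \lambda_{32}-\lambda_{31}-1,\ \lambda'_{21}+\lambda'_{22}+\lambda_{33}-1,\ n+\lambda'_{21}+\lambda'_{22}-\lambda_{31}-1,\ -\lambda'_{21}-\lambda'_{22}-\lambda_{31}-1\big)\\ &\times K_{\ell+\lambda_{21}+\lambda_{22}}\big(\ell+\lambda'_{21}+\lambda'_{22};\sin^2\theta,2\ell-n\big)\\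 &\times\widetilde R_{\lambda_{31}-\lambda_{21}}\big(\lambda_{31}-\ell;\ \lambda_{32}-\lambda_{31}-1,\ \lambda_{21}+\lambda_{22}+\lambda_{33}-1,\ n+\lambda_{21}+\lambda_{22}-\lambda_{31}-1,\ -\lambda_{21}-\lambda_{22}-\lambda_{31}-1\big)\\ &\times K_{\lambda_{11}-\lambda_{22}}\big(n+\lambda_{21};\sin^2\chi,\lambda_{21}-\lambda_{22}\big),\end{aligned}$$ where both sums run in unit steps (empty sums being $0$), $$\ell_{min}=\max\{\lambda_{32},\ n-\lambda_{32},\ -\lambda_{21}-\lambda_{22},\ n+\lambda_{21}+\lambda_{22},\ -\lambda'_{21}-\lambda'_{22},\ n+\lambda'_{21}+\lambda'_{22}\},$$ $$\begin{aligned}\mu_{\Lambda',\Lambda}(\ell,n)=&(-1)^{\lambda'_{11}+\ell-n}\,t(\lambda'_{21},\,n+\lambda'_{21}+\lambda'_{22},\,\lambda'_{22})\;t(\ell,\,n+\lambda_{21}+\lambda_{22},\,n-\ell)\\ &\times\frac{(\lambda'_{21}-\lambda'_{22})!\,(2\ell-n)!\,(\lambda_{21}-\lambda_{22})!\ \cos^{\lambda'_{21}-\lambda'_{22}}(\phi)\,\cos^{2\ell-n}(\theta)\,\cos^{\lambda_{21}-\lambda_{22}}(\chi)}{(n+\lambda'_{21})!\,(\lambda'_{21}-\lambda'_{11})!\,(\ell+\lambda_{21}+\lambda_{22})!\,(\ell-n-\lambda'_{21}-\lambda'_{22})!\,(\lambda_{11}-\lambda_{22})!\,(-n-\lambda_{22})!}\\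 &\times\tan^{n+\lambda'_{11}+\lambda'_{21}-\lambda'_{22}}(\phi)\ \tan^{2\ell+\lambda'_{21}+\lambda'_{22}+\lambda_{21}+\lambda_{22}}(\theta)\ \tan^{n+\lambda_{11}+\lambda_{21}-\lambda_{22}}(\chi),\end{aligned}$$ and $$t(x,y,z)=(x-z+1)\frac{(\lambda_{31}-\lambda_{32})!\,(\lambda_{31}-\lambda_{33}+1)!\,(\lambda_{31}-y)!\,(\lambda_{32}-z)!\,(y-z)!}{(x-\lambda_{32})!\,(x-\lambda_{33}+1)!\,(x-y)!\,(\lambda_{31}-z+1)!\,(\lambda_{31}-x)!\,(z-\lambda_{33})!}.$$ (At angles whose sine or cosine vanishes, the right-hand side is understood through its continuous extension in the angles.)
   Context: **Representation.** $sl_3$ is the complex Lie algebra of traceless $3\times3$ matrices; $e_{ij}=E_{ij}-\frac{\delta_{ij}}{3}I$ for $1\le i,j\le 3$, with $E_{ij}$ the matrix units. A highest weight is $\lambda=(\lambda_{31},\lambda_{32},\lambda_{33})$ with $\lambda_{31}-\lambda_{32},\lambda_{32}-\lambda_{33}\in\mathbb Z_{\ge0}$ and $\lambda_{31}+\lambda_{32}+\lambda_{33}=0$. The set $\mathcal P_\lambda$ of Gelfand--Tsetlin (GT) patterns consists of the triples $\Lambda=(\lambda_{11},\lambda_{21},\lambda_{22})$ such that $\lambda_{31}-\lambda_{21}$, $\lambda_{21}-\lambda_{32}$, $\lambda_{32}-\lambda_{22}$, $\lambda_{22}-\lambda_{33}$, $\lambda_{21}-\lambda_{11}$, $\lambda_{11}-\lambda_{22}$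 all lie in $\mathbb Z_{\ge0}$. $V_\lambda$ is the irreducible $sl_3$-module with basis $(\xi_\Lambda)_{\Lambda\in\mathcal P_\lambda}$ and action $e_{11}\xi_\Lambda=\lambda_{11}\xi_\Lambda$, $e_{22}\xi_\Lambda=(\lambda_{21}+\lambda_{22}-\lambda_{11})\xi_\Lambda$, $e_{33}\xi_\Lambda=-(\lambda_{21}+\lambda_{22})\xi_\Lambda$, $e_{12}\xi_\Lambda=(\lambda_{21}-\lambda_{11})(\lambda_{11}-\lambda_{22}+1)\xi_{\Lambda+\delta^{11}}$, $e_{21}\xi_\Lambda=\xi_{\Lambda-\delta^{11}}$, $e_{23}\xi_\Lambda=\frac{\lambda_{31}-\lambda_{21}}{\lambda_{21}-\lambda_{22}+1}\xi_{\Lambda+\delta^{21}}+\frac{\lambda_{31}-\lambda_{22}+1}{\lambda_{21}-\lambda_{22}+1}\xi_{\Lambda+\delta^{22}}$, $e_{32}\xi_\Lambda=\frac{(\lambda_{21}-\lambda_{32})(\lambda_{21}-\lambda_{33}+1)(\lambda_{21}-\lambda_{11})}{\lambda_{21}-\lambda_{22}+1}\xi_{\Lambda-\delta^{21}}+\frac{(\lambda_{11}-\lambda_{22}+1)(\lambda_{32}-\lambda_{22}+1)(\lambda_{22}-\lambda_{33})}{\lambda_{21}-\lambda_{22}+1}\xi_{\Lambda-\delta^{22}}$, $e_{13}=[e_{12},e_{23}]$, $e_{31}=[e_{32},e_{21}]$, where $\Lambda\pm\delta^{ij}$ means $\lambda_{ij}$ replaced by $\lambda_{ij}\pm1$ and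 $\xi_{\Lambda\pm\delta^{ij}}=0$ if the result is not in $\mathcal P_\lambda$. **Rotations.** $V_\lambda$ integrates to a representation $\pi$ of $SL_3(\mathbb C)\supset SO(3)$. The operator representing $S^{-1}$ is $\sigma=\pi(S^{-1})$; thus $\sigma^{-1}g\,\sigma=SgS^{-1}$ (as operators on $V_\lambda$) for $g\in sl_3$. $$R^z_\phi=\begin{pmatrix}\cos\phi&\sin\phi&0\\-\sin\phi&\cos\phi&0\\0&0&1\end{pmatrix},\qquad R^y_\theta=\begin{pmatrix}\cos\theta&0&-\sin\theta\\0&1&0\\\sin\theta&0&\cos\theta\end{pmatrix}.$$ **Polynomials.** Krawtchouk: $K_n(x;p,N)={}_2F_1\left({-n,\,-x\atop -N}\Big|\frac1p\right)$ for integers $0\le n,x\le N$, and $K_n(x;p,N)=0$ if $n$ or $x$ is outside $\{0,\dots,N\}$. Racah: $\widetilde R_n(x;\alpha,\beta,\gamma,\delta)={}_4F_3\left({-n,\ n+\alpha+\beta+1,\ -x,\ x+\gamma+\delta+1\atop \alpha+1,\ \beta+\delta+1,\ \gamma+1}\Big|1\right)$, and it is $0$ if $n$ or $x$ is outside $\{0,\dots,N\}$ with $N=\min(-\alpha-1,-\beta-\delta-1,-\gamma-1)$. The hypergeometric sums are the finite sums over $0\le k\le\min(n,x)$. *)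

theory Defs
  imports "HOL-Analysis.Analysis"
begin

section \<open>Gelfand--Tsetlin patterns and the module they span\<close>

text \<open>
  A highest weight is a triple (l31, l32, l33) and a pattern is a triple (l11, l21, l22).
  The entries are real numbers, not integers: they lie in a common coset of the integers
  inside the set of multiples of 1/3.
\<close>

type_synonym triple = "real \<times> real \<times> real"

fun highest_weight :: "triple \<Rightarrow> bool" where
  "highest_weight (l31, l32, l33) \<longleftrightarrow>
     l31 - l32 \<in> \<nat> \<and> l32 - l33 \<in> \<nat> \<and> l31 + l32 + l33 = 0"

fun gt_patterns :: "triple \<Rightarrow> triple set" where
  "gt_patterns (l31, l32, l33) =
     {(l11, l21, l22). l31 - l21 \<in> \<nat> \<and> l21 - l32 \<in> \<nat> \<and> l32 - l22 \<in> \<nat> \<and>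
        l22 - l33 \<in> \<nat> \<and> l21 - l11 \<in> \<nat> \<and> l11 - l22 \<in> \<nat>}"

type_synonym gt_vector = "triple \<Rightarrow> complex"

text \<open>
  A vector is given by its coordinates, so the module consists of the functions supported on
  the patterns. The vector \<open>\<xi> lam L\<close> is zero if \<open>L\<close> is not a pattern.
\<close>

definition gt_space :: "triple \<Rightarrow> gt_vector set" where
  "gt_space lam = {v. \<forall>L. L \<notin> gt_patterns lam \<longrightarrow> v L = 0}"

definition \<xi> :: "triple \<Rightarrow> triple \<Rightarrow> gt_vector" where
  "\<xi> lam L = (\<lambda>M. if L \<in> gt_patterns lam \<and> M = L then 1 else 0)"

definition lin_ext :: "triple \<Rightarrow> (triple \<Rightarrow> gt_vector) \<Rightarrow> gt_vector \<Rightarrow> gt_vector" where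
  "lin_ext lam f v = (\<lambda>M. \<Sum>L\<in>gt_patterns lam. v L * f L M)"

definition op_commutator ::
    "(gt_vector \<Rightarrow> gt_vector) \<Rightarrow> (gt_vector \<Rightarrow> gt_vector) \<Rightarrow> gt_vector \<Rightarrow> gt_vector" where
  "op_commutator A B v = (\<lambda>M. A (B v) M - B (A v) M)"

definition e11 :: "triple \<Rightarrow> gt_vector \<Rightarrow> gt_vector" where
  "e11 lam = lin_ext lam (\<lambda>(l11, l21, l22) M. of_real l11 * \<xi> lam (l11, l21, l22) M)"

definition e22 :: "triple \<Rightarrow> gt_vector \<Rightarrow> gt_vector" where
  "e22 lam = lin_ext lam (\<lambda>(l11, l21, l22) M.
     of_real (l21 + l22 - l11) * \<xi> lam (l11, l21, l22) M)"

definition e33 :: "triple \<Rightarrow> gt_vector \<Rightarrow> gt_vector" where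
  "e33 lam = lin_ext lam (\<lambda>(l11, l21, l22) M.
     of_real (- (l21 + l22)) * \<xi> lam (l11, l21, l22) M)"

definition e12 :: "triple \<Rightarrow> gt_vector \<Rightarrow> gt_vector" where
  "e12 lam = lin_ext lam (\<lambda>(l11, l21, l22) M.
     of_real ((l21 - l11) * (l11 - l22 + 1)) * \<xi> lam (l11 + 1, l21, l22) M)"

definition e21 :: "triple \<Rightarrow> gt_vector \<Rightarrow> gt_vector" where
  "e21 lam = lin_ext lam (\<lambda>(l11, l21, l22) M. \<xi> lam (l11 - 1, l21, l22) M)"

definition e23 :: "triple \<Rightarrow> gt_vector \<Rightarrow> gt_vector" where
  "e23 lam = (let (l31, l32, l33) = lam in lin_ext lam (\<lambda>(l11, l21, l22) M.
     of_real ((l31 - l21) / (l21 - l22 + 1)) * \<xi> lam (l11, l21 + 1, l22) M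
   + of_real ((l31 - l22 + 1) / (l21 - l22 + 1)) * \<xi> lam (l11, l21, l22 + 1) M))"

definition e32 :: "triple \<Rightarrow> gt_vector \<Rightarrow> gt_vector" where
  "e32 lam = (let (l31, l32, l33) = lam in lin_ext lam (\<lambda>(l11, l21, l22) M.
     of_real ((l21 - l32) * (l21 - l33 + 1) * (l21 - l11) / (l21 - l22 + 1))
       * \<xi> lam (l11, l21 - 1, l22) M
   + of_real ((l11 - l22 + 1) * (l32 - l22 + 1) * (l22 - l33) / (l21 - l22 + 1))
       * \<xi> lam (l11, l21, l22 - 1) M))"

definition e13 :: "triple \<Rightarrow> gt_vector \<Rightarrow> gt_vector" where
  "e13 lam = op_commutator (e12 lam) (e23 lam)"

definition e31 :: "triple \<Rightarrow> gt_vector \<Rightarrow> gt_vector" where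
  "e31 lam = op_commutator (e32 lam) (e21 lam)"

text \<open>
  For a traceless matrix X we have X = sum of X(i,j) E(i,j) = sum of X(i,j) e(i,j), because the
  multiples of the identity in the diagonal elements e(i,i) cancel. Hence the following is the
  action of X on the module. It is only meant for traceless X.
\<close>

definition sl3_action :: "triple \<Rightarrow> complex^3^3 \<Rightarrow> gt_vector \<Rightarrow> gt_vector" where
  "sl3_action lam X v = (\<lambda>M.
       X$1$1 * e11 lam v M + X$1$2 * e12 lam v M + X$1$3 * e13 lam v M
     + X$2$1 * e21 lam v M + X$2$2 * e22 lam v M + X$2$3 * e23 lam v M
     + X$3$1 * e31 lam v M + X$3$2 * e32 lam v M + X$3$3 * e33 lam v M)"

section \<open>The group representation\<close>

definition SL3 :: "(complex^3^3) set" where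
  "SL3 = {g. det g = 1}"

definition sl3 :: "(complex^3^3) set" where
  "sl3 = {X. trace X = 0}"

definition one_parameter_subgroup :: "complex^3^3 \<Rightarrow> (real \<Rightarrow> complex^3^3) \<Rightarrow> bool" where
  "one_parameter_subgroup X g \<longleftrightarrow>
     (\<forall>t. g t \<in> SL3) \<and> (\<forall>s t. g (s + t) = g s ** g t) \<and> (g has_vector_derivative X) (at 0)"

text \<open>
  A representation of the group on the module whose differential is \<open>sl3_action lam\<close>. The
  one-parameter subgroup with velocity X is t \<open>\<mapsto>\<close> exp(tX), so the last clause says that
  the derivative of rep(exp(tX)) at t = 0 is the action of X. Continuity (and holomorphy)
  follows from the clauses, as does uniqueness of \<open>rep\<close> on \<open>SL3\<close>. Nothing is required of
  \<open>rep\<close> outside \<open>SL3\<close> and \<open>gt_space lam\<close>.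
\<close>

definition integrates_sl3_action ::
    "triple \<Rightarrow> (complex^3^3 \<Rightarrow> gt_vector \<Rightarrow> gt_vector) \<Rightarrow> bool" where
  "integrates_sl3_action lam rep \<longleftrightarrow>
     (\<forall>g\<in>SL3. \<forall>v\<in>gt_space lam. rep g v \<in> gt_space lam) \<and>
     (\<forall>g\<in>SL3. \<forall>v\<in>gt_space lam. \<forall>w\<in>gt_space lam. \<forall>a b.
        rep g (\<lambda>M. a * v M + b * w M) = (\<lambda>M. a * rep g v M + b * rep g w M)) \<and>
     (\<forall>v\<in>gt_space lam. rep (mat 1) v = v) \<and>
     (\<forall>g\<in>SL3. \<forall>h\<in>SL3. \<forall>v\<in>gt_space lam. rep (g ** h) v = rep g (rep h v)) \<and>
     (\<forall>X\<in>sl3. \<forall>g. one_parameter_subgroup X g \<longrightarrow>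
        (\<forall>v\<in>gt_space lam. \<forall>M.
           ((\<lambda>t. rep (g t) v M) has_vector_derivative sl3_action lam X v M) (at 0)))"

definition Rz :: "real \<Rightarrow> real^3^3" where
  "Rz phi = vector [vector [cos phi, sin phi, 0],
                    vector [- sin phi, cos phi, 0],
                    vector [0, 0, 1]]"

definition Ry :: "real \<Rightarrow> real^3^3" where
  "Ry theta = vector [vector [cos theta, 0, - sin theta],
                      vector [0, 1, 0],
                      vector [sin theta, 0, cos theta]]"

definition complex_matrix :: "real^3^3 \<Rightarrow> complex^3^3" where
  "complex_matrix A = (\<chi> i j. of_real (A$i$j))"

section \<open>Krawtchouk and Racah polynomials\<close>

text \<open>
  The finite hypergeometric sum over k = 0, ..., m. The arguments of the polynomials are real
  because the parameters below are differences of pattern entries.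
\<close>

definition hypergeo_sum :: "nat \<Rightarrow> real list \<Rightarrow> real list \<Rightarrow> real \<Rightarrow> real" where
  "hypergeo_sum m as bs z = (\<Sum>k\<le>m. fps_nth (fps_hypergeo as bs z) k)"

definition krawtchouk :: "real \<Rightarrow> real \<Rightarrow> real \<Rightarrow> real \<Rightarrow> real" where
  "krawtchouk n x p N =
     (if n \<in> \<nat> \<and> x \<in> \<nat> \<and> n \<le> N \<and> x \<le> N
      then hypergeo_sum (nat \<lfloor>min n x\<rfloor>) [- n, - x] [- N] (1 / p) else 0)"

definition racah :: "real \<Rightarrow> real \<Rightarrow> real \<Rightarrow> real \<Rightarrow> real \<Rightarrow> real \<Rightarrow> real" where
  "racah n x \<alpha> \<beta> \<gamma> \<delta> =
     (let N = Min {- \<alpha> - 1, - \<beta> - \<delta> - 1, - \<gamma> - 1} in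
      if n \<in> \<nat> \<and> x \<in> \<nat> \<and> n \<le> N \<and> x \<le> N
      then hypergeo_sum (nat \<lfloor>min n x\<rfloor>)
             [- n, n + \<alpha> + \<beta> + 1, - x, x + \<gamma> + \<delta> + 1] [\<alpha> + 1, \<beta> + \<delta> + 1, \<gamma> + 1] 1
      else 0)"

section \<open>The matrix element formula\<close>

text \<open>
  Factorials and powers are only used at reals that are integers. In the range of the double
  sum all arguments of factorials and all exponents of cosines and tangents are nonnegative.
\<close>

definition ifact :: "real \<Rightarrow> real" where
  "ifact x = fact (nat \<lfloor>x\<rfloor>)"

definition ipow :: "real \<Rightarrow> real \<Rightarrow> real" where
  "ipow x k = x powi \<lfloor>k\<rfloor>"

definition unit_steps :: "real \<Rightarrow> real \<Rightarrow> real set" where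
  "unit_steps a b = {x. a \<le> x \<and> x \<le> b \<and> x - a \<in> \<int>}"

fun t_coeff :: "triple \<Rightarrow> real \<Rightarrow> real \<Rightarrow> real \<Rightarrow> real" where
  "t_coeff (l31, l32, l33) x y z =
     (x - z + 1) *
     (ifact (l31 - l32) * ifact (l31 - l33 + 1) * ifact (l31 - y) * ifact (l32 - z) * ifact (y - z)) /
     (ifact (x - l32) * ifact (x - l33 + 1) * ifact (x - y) * ifact (l31 - z + 1)
        * ifact (l31 - x) * ifact (z - l33))"

text \<open>The primed pattern comes first, as in the index of the matrix element. The angles are
  (chi, theta, phi).\<close>

definition \<mu> :: "triple \<Rightarrow> triple \<Rightarrow> triple \<Rightarrow> triple \<Rightarrow> real \<Rightarrow> real \<Rightarrow> real" where
  "\<mu> lam L' L ang l n =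
     (let (l11', l21', l22') = L'; (l11, l21, l22) = L; (chi, theta, phi) = ang in
     ipow (- 1) (l11' + l - n)
     * t_coeff lam l21' (n + l21' + l22') l22' * t_coeff lam l (n + l21 + l22) (n - l)
     * (ifact (l21' - l22') * ifact (2 * l - n) * ifact (l21 - l22)
        * ipow (cos phi) (l21' - l22') * ipow (cos theta) (2 * l - n) * ipow (cos chi) (l21 - l22)
        / (ifact (n + l21') * ifact (l21' - l11') * ifact (l + l21 + l22)
           * ifact (l - n - l21' - l22') * ifact (l11 - l22) * ifact (- n - l22)))
     * ipow (tan phi) (n + l11' + l21' - l22')
     * ipow (tan theta) (2 * l + l21' + l22' + l21 + l22)
     * ipow (tan chi) (n + l11 + l21 - l22))"

definition matrix_element_sum :: "triple \<Rightarrow> triple \<Rightarrow> triple \<Rightarrow> triple \<Rightarrow> real" where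
  "matrix_element_sum lam L' L ang =
     (let (l31, l32, l33) = lam; (l11', l21', l22') = L'; (l11, l21, l22) = L;
          (chi, theta, phi) = ang in
      \<Sum>n\<in>unit_steps (max (- l21) (- l21')) (min (- l22) (- l22')).
      \<Sum>l\<in>unit_steps
             (Max {l32, n - l32, - l21 - l22, n + l21 + l22, - l21' - l22', n + l21' + l22'})
             (min l31 (n - l33)).
        \<mu> lam L' L ang l n
        * krawtchouk (n + l21') (l11' - l22') ((sin phi)\<^sup>2) (l21' - l22')
        * racah (l31 - l21') (l31 - l) (l32 - l31 - 1) (l21' + l22' + l33 - 1)
            (n + l21' + l22' - l31 - 1) (- l21' - l22' - l31 - 1)
        * krawtchouk (l + l21 + l22) (l + l21' + l22') ((sin theta)\<^sup>2) (2 * l - n)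
        * racah (l31 - l21) (l31 - l) (l32 - l31 - 1) (l21 + l22 + l33 - 1)
            (n + l21 + l22 - l31 - 1) (- l21 - l22 - l31 - 1)
        * krawtchouk (l11 - l22) (n + l21) ((sin chi)\<^sup>2) (l21 - l22))"

text \<open>
  The triples of angles at which the double sum is literally defined. They form a dense set, so
  a limit within this set determines the value of the continuous extension.
\<close>

definition generic_angles :: "triple set" where
  "generic_angles = {(chi, theta, phi).
     sin chi \<noteq> 0 \<and> cos chi \<noteq> 0 \<and> sin theta \<noteq> 0 \<and> cos theta \<noteq> 0 \<and> sin phi \<noteq> 0 \<and> cos phi \<noteq> 0}"

end

theory Submission
  imports Defs "HOL-Library.Function_Algebras"
begin

text \<open>
  In \<open>sl3\<close>, exchanging the coordinates 2 and 3 turns a rotation about the y axis into one about the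
  z axis. Hence \<open>\<sigma> = Z(\<phi>) W Z(-\<theta>) W Z(\<chi>)\<close>, where \<open>Z(t)\<close> is the exponential of \<open>-t (e12 - e21)\<close>
  and \<open>W\<close> is an involution with \<open>W e12 = e13 W\<close> and \<open>W e21 = e31 W\<close>. The operator \<open>Z(t)\<close> only changes the
  entry \<open>\<lambda>\<^sub>1\<^sub>1\<close>, and there it is a rotation of binary forms, whose coefficients are Krawtchouk polynomials;
  the entries of \<open>W\<close> are Racah polynomials. The five factors are the five polynomials of the formula.

  \<open>W\<close> is defined by its entries. The relation \<open>W e13 = e12 W\<close> holds termwise in the hypergeometric sums, up
  to boundary terms, which are vanishing Saalschuetzian sums, and \<open>W e21 = e31 W\<close> is its transpose with
  respect to the contravariant form. All other relations, including \<open>W W = 1\<close>, follow because the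
  difference of their two sides intertwines \<open>e21\<close> and \<open>e13\<close> with other operators and kills the
  extremal weight vector that generates the module under \<open>e21\<close> and \<open>e13\<close>.
\<close>

section \<open>Vanishing Saalschuetzian sums\<close>

text \<open>The permutation matrix that exchanges coordinates 2 and 3 has determinant -1, but its
  negative lies in \<open>SL3\<close> and squares to 1. Up to sign, W is its action on the module.
  Its entries are not derived from the group, since \<open>rep\<close> is known only through its
  differential at the identity: all relations of W are checked in the Lie algebra, and
  \<open>rep\<close> is matched with the explicit matrices through a linear differential equation.
  The obstacle is the boundary of the pattern polytope. The coefficients of \<open>e13\<close> and
  \<open>e21\<close> need not vanish where the target stops being a pattern, and an identity between
  hypergeometric terms does not see these walls; each leftover coefficient has to be shown to
  vanish. The rotation matrices are defined as coefficients of powers of linear forms, which makes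
  sense at every angle. The Krawtchouk form divides by sines and cosines and holds at generic angles
  only; continuity of the matrices then supplies the limit statement.\<close>

lemma alternating_binomial_sum_eq_0:
  fixes q :: "real poly"
  assumes "degree q < n"
  shows "(\<Sum>k\<le>n. (- 1) ^ k * of_nat (n choose k) * poly q (of_nat k)) = 0"
  using assms
proof (induction n arbitrary: q)
  case (Suc n)
  obtain c r where q: "q = pCons c r" by (cases q)
  have const: "(\<Sum>k\<le>Suc n. (- 1) ^ k * of_nat (Suc n choose k) * c) = 0"
    using choose_alternating_sum[of "Suc n", where 'a = real] by (simp add: sum_distrib_right[symmetric])
  \<comment> \<open>The sum is a finite difference of order \<open>Suc n\<close>. Absorption, k
    C(n+1, k) = (n+1) C(n, k-1), turns the non-constant part of \<open>q\<close> into a difference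
    of order \<open>n\<close> of the shifted quotient \<open>r\<close>, whose degree is one
    less.\<close>
  have "(\<Sum>k\<le>Suc n. (- 1) ^ k * of_nat (Suc n choose k) * (of_nat k * poly r (of_nat k)))
      = (\<Sum>k\<le>n. (- 1) ^ Suc k * (of_nat (Suc n choose Suc k) * of_nat (Suc k)) * poly r (of_nat (Suc k)))"
    unfolding sum.atMost_Suc_shift by (simp add: mult_ac)
  also have "\<dots> = (\<Sum>k\<le>n. (- 1) ^ Suc k * (of_nat (Suc n) * of_nat (n choose k)) * poly r (of_nat (Suc k)))"
    by (metis (no_types, opaque_lifting) Suc_times_binomial mult.commute of_nat_mult)
  also have "\<dots> = - of_nat (Suc n) * (\<Sum>k\<le>n. (- 1) ^ k * of_nat (n choose k) * poly (r \<circ>\<^sub>p [:1, 1:]) (of_nat k))"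
    by (simp add: sum_distrib_left poly_pcompose mult_ac algebra_simps)
  also have "\<dots> = 0"
  proof (cases "r = 0")
    case False
    then have "degree (r \<circ>\<^sub>p [:1, 1:]) < n"
      using Suc.prems q by (simp add: degree_pcompose)
    then show ?thesis by (simp add: Suc.IH)
  qed simp
  finally show ?case
    using const by (simp add: q distrib_left sum.distrib del: sum.atMost_Suc)
qed simp

text \<open>Both sides equal the negative of the Pochhammer symbol of -a with k + 1 factors, split
  off at its first or at its last factor.\<close>

lemma pochhammer_minus_shift:
  "of_int a * pochhammer (1 - of_int a) k = (of_int a - of_nat k) * pochhammer (- of_int a :: real) k"
  using pochhammer_rec[of "- of_int a :: real" k] pochhammer_rec'[of "- of_int a :: real" k]
  by (simp add: algebra_simps)

text \<open>Each step from \<open>a\<close> to \<open>a - 1\<close> contributes one linear factor 1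
  - k/a, starting from the constant 1 at \<open>a = p\<close>. For k > p the denominator vanishes,
  hence the restriction on k.\<close>

lemma pochhammer_ratio_poly:
  fixes a p :: int
  assumes "0 \<le> a" "a \<le> p"
  shows "\<exists>q :: real poly. degree q \<le> nat (p - a) \<and>
    (\<forall>k. of_nat k \<le> p \<longrightarrow> pochhammer (- of_int a) k / pochhammer (- of_int p) k = poly q (of_nat k))"
  using assms(2,1)
proof (induction a rule: int_le_induct)
  case base
  have "pochhammer (- of_int p :: real) k \<noteq> 0" if "of_nat k \<le> p" for k
    using that base by (auto simp: pochhammer_eq_0_iff)
  then show ?case by (intro exI[of _ 1]) auto
next
  case (step a)
  then obtain q :: "real poly" where q: "degree q \<le> nat (p - a)"
    "\<And>k. of_nat k \<le> p \<Longrightarrow> pochhammer (- of_int a) k / pochhammer (- of_int p) k = poly q (of_nat k)"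
    by auto
  have "pochhammer (- of_int (a - 1)) k / pochhammer (- of_int p) k = poly (q * [:1, - 1 / of_int a:]) (of_nat k)"
    if "of_nat k \<le> p" for k
  proof -
    have "pochhammer (- of_int (a - 1)) k = (1 - of_nat k / of_int a) * pochhammer (- of_int a :: real) k"
      using pochhammer_minus_shift[of a k] step by (simp add: field_simps)
    then have "pochhammer (- of_int (a - 1)) k / pochhammer (- of_int p) k
        = (1 - of_nat k / of_int a) * (pochhammer (- of_int a :: real) k / pochhammer (- of_int p) k)"
      by (simp only: times_divide_eq_right)
    also have "\<dots> = poly (q * [:1, - 1 / of_int a:]) (of_nat k)"
      unfolding q(2)[OF that] by (simp add: algebra_simps)
    finally show ?thesis .
  qed
  moreover have "degree (q * [:1, - 1 / of_int a:]) \<le> nat (p - (a - 1))"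
    using degree_mult_le[of q "[:1, - 1 / of_int a:]"] q(1) step by (simp add: nat_diff_distrib' split: if_splits)
  ultimately show ?case by blast
qed

lemma pochhammer_minus_nat:
  "k \<le> n \<Longrightarrow> pochhammer (- real n) k / fact k = (- 1) ^ k * of_nat (n choose k)"
  by (simp add: pochhammer_minus' binomial_gbinomial gbinomial_pochhammer)

text \<open>The two quotients are polynomials in k of joint degree at most (p - a) + (q - b), which
  is less than n, so the sum is a vanishing difference of order n.\<close>

lemma saalschuetz_vanishing:
  fixes n a b p q :: int
  assumes "0 \<le> a" "a \<le> p" "0 \<le> b" "b \<le> q" "n \<le> p" "n \<le> q" "p + q - a - b < n"
  shows "(\<Sum>k\<le>nat n. pochhammer (- of_int n) k / fact k
            * (pochhammer (- of_int a) k / pochhammer (- of_int p) k)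
            * (pochhammer (- of_int b) k / pochhammer (- of_int q) k)) = (0 :: real)"
proof -
  obtain f g :: "real poly" where f: "degree f \<le> nat (p - a)"
     "\<And>k. of_nat k \<le> p \<Longrightarrow> pochhammer (- of_int a) k / pochhammer (- of_int p) k = poly f (of_nat k)"
   and g: "degree g \<le> nat (q - b)"
     "\<And>k. of_nat k \<le> q \<Longrightarrow> pochhammer (- of_int b) k / pochhammer (- of_int q) k = poly g (of_nat k)"
    using pochhammer_ratio_poly[of a p] pochhammer_ratio_poly[of b q] assms by blast
  obtain N where N: "n = int N"
    using assms zero_le_imp_eq_int[of n] by auto
  have "degree (f * g) < N"
    using degree_mult_le[of f g] f(1) g(1) assms N by linarith
  then have "0 = (\<Sum>k\<le>N. (- 1) ^ k * of_nat (N choose k) * poly (f * g) (of_nat k))"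
    by (simp only: alternating_binomial_sum_eq_0)
  also have "\<dots> = (\<Sum>k\<le>nat n. pochhammer (- of_int n) k / fact k
            * (pochhammer (- of_int a) k / pochhammer (- of_int p) k)
            * (pochhammer (- of_int b) k / pochhammer (- of_int q) k))"
    using f(2) g(2) assms N by (intro sum.cong) (auto simp: pochhammer_minus_nat)
  finally show ?thesis ..
qed

section \<open>Matrices indexed by integer patterns\<close>

type_synonym idx = "int \<times> int \<times> int"
type_synonym imat = "idx \<Rightarrow> idx \<Rightarrow> real"

abbreviation poch :: "int \<Rightarrow> nat \<Rightarrow> real" where
  "poch a k \<equiv> pochhammer (- of_int a) k"

text \<open>Note that \<open>ifac n = 1\<close> for negative \<open>n\<close>.\<close>

definition ifac :: "int \<Rightarrow> real" where
  "ifac n = fact (nat n)"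

lemma ifac_rec: "n > 0 \<Longrightarrow> ifac n = of_int n * ifac (n - 1)"
  by (cases n rule: int_cases3) (auto simp: ifac_def fact_reduce nat_diff_distrib)

lemma ifac_0 [simp]: "ifac 0 = 1"
  by (simp add: ifac_def)

lemma ifac_pos [simp]: "ifac n > 0" "ifac n \<noteq> 0"
  by (auto simp: ifac_def)

lemma sum_two:
  assumes "finite A" "\<And>k. k \<in> A \<Longrightarrow> k \<noteq> x \<Longrightarrow> k \<noteq> y \<Longrightarrow> f k = 0" "x \<noteq> y"
  shows "sum f A = (if x \<in> A then f x else 0) + (if y \<in> A then f y else (0::real))"
proof -
  have "sum f A = sum f (A \<inter> {x, y})"
    using assms by (intro sum.mono_neutral_right) auto
  also have "\<dots> = (if x \<in> A then f x else 0) + (if y \<in> A then f y else 0)"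
    using assms(3) by (auto simp: Int_insert_right)
  finally show ?thesis .
qed

lemma sum_one:
  assumes "finite A" "\<And>k. k \<in> A \<Longrightarrow> k \<noteq> x \<Longrightarrow> f k = 0"
  shows "sum f A = (if x \<in> A then f x else (0::real))"
proof -
  have "sum f A = sum f (A \<inter> {x})"
    using assms by (intro sum.mono_neutral_right) auto
  then show ?thesis by (auto simp: Int_insert_right)
qed

text \<open>This is the diagonal entry of the relation between \<open>e13\<close> and
  \<open>e31\<close>. In terms of d = b - a the only denominators are d, d - 1 and d + 1; after
  clearing them a polynomial identity remains.\<close>

lemma comm_e13_e31_diag:
  fixes a b c p P :: real
  assumes "b \<noteq> a" "b \<noteq> a + 1" "b \<noteq> a - 1"
  shows "(p - a) * (P - a) / (b - a) * ((a + 1) * (b - (c + 1)) / (b - (a + 1)))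
    + (b - p) * (P - b) / (b - a) * ((b + 1) * (c + 1 - a) / (b + 1 - a))
    = a * (b - c) / (b - a) * ((p - (a - 1)) * (P - (a - 1)) / (b - (a - 1)))
    + b * (c - a) / (b - a) * ((b - 1 - p) * (P - (b - 1)) / (b - 1 - a)) + (p + P - a - b - c)"
proof -
  define d where "d = b - a"
  have b: "b = a + d" by (simp add: d_def)
  have d: "d \<noteq> 0" "d - 1 \<noteq> 0" "d + 1 \<noteq> 0" using assms by (auto simp: d_def)
  have "x / d * (y / (d - 1)) + z / d * (w / (d + 1)) = x' / d * (y' / (d + 1)) + z' / d * (w' / (d - 1)) + r"
    if "x * y * (d + 1) + z * w * (d - 1) = x' * y' * (d - 1) + z' * w' * (d + 1) + r * d * (d - 1) * (d + 1)"
    for x y z w x' y' z' w' r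
    using that d by (simp add: divide_simps) (simp add: algebra_simps)
  note * = this
  have **: "a + d - (a + 1) = d - 1" "a + d + 1 - a = d + 1" "a + d - (a - 1) = d + 1" "a + d - 1 - a = d - 1"
    by simp_all
  show ?thesis unfolding b add_diff_cancel_left' ** by (rule *) algebra
qed

text \<open>
  A pattern is encoded by the integers \<open>a = \<lambda>\<^sub>3\<^sub>1 - \<lambda>\<^sub>2\<^sub>1\<close>, \<open>b = \<lambda>\<^sub>3\<^sub>1 - \<lambda>\<^sub>2\<^sub>2 + 1\<close> and \<open>c = \<lambda>\<^sub>3\<^sub>1 - \<lambda>\<^sub>1\<^sub>1\<close>, the highest weight by
  \<open>p = \<lambda>\<^sub>3\<^sub>1 - \<lambda>\<^sub>3\<^sub>2\<close> and \<open>P = \<lambda>\<^sub>3\<^sub>1 - \<lambda>\<^sub>3\<^sub>3 + 1\<close>. The shift by 1 makes the formulas symmetric in \<open>a\<close> and \<open>b\<close>.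
\<close>

locale gt_index =
  fixes p P :: int
  assumes p_nonneg: "0 \<le> p" and p_less: "p < P"
begin

definition pats :: "idx set" where
  "pats = {(a, b, c). 0 \<le> a \<and> a \<le> p \<and> p < b \<and> b \<le> P \<and> a \<le> c \<and> c < b}"

lemma mem_pats [simp]:
  "(a, b, c) \<in> pats \<longleftrightarrow> 0 \<le> a \<and> a \<le> p \<and> p < b \<and> b \<le> P \<and> a \<le> c \<and> c < b"
  by (simp add: pats_def)

lemma finite_pats [simp]: "finite pats"
  by (rule finite_subset[of _ "{0..p} \<times> {p..P} \<times> {0..P}"]) (auto simp: pats_def)

section \<open>The algebra of matrices supported on the patterns\<close>

definition supported :: "imat \<Rightarrow> bool" where
  "supported A \<longleftrightarrow> (\<forall>i j. i \<notin> pats \<or> j \<notin> pats \<longrightarrow> A i j = 0)"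

lemma supportedD: "supported A \<Longrightarrow> i \<notin> pats \<or> j \<notin> pats \<Longrightarrow> A i j = 0"
  unfolding supported_def by blast

text \<open>The cutoff encodes that a basis vector outside the patterns is zero. It matters where
  the coefficient does not vanish by itself, for example for \<open>e13m\<close> at
  \<open>b = p + 1\<close>.\<close>

definition restr :: "imat \<Rightarrow> imat" where
  "restr A = (\<lambda>i j. if i \<in> pats \<and> j \<in> pats then A i j else 0)"

lemma supported_restr [simp]: "supported (restr A)"
  unfolding supported_def restr_def by meson

definition mm :: "imat \<Rightarrow> imat \<Rightarrow> imat" (infixl "\<star>" 70) where
  "A \<star> B = (\<lambda>i j. \<Sum>k\<in>pats. A i k * B k j)"

lemma supported_mm [simp]: "supported A \<Longrightarrow> supported B \<Longrightarrow> supported (A \<star> B)"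
  unfolding supported_def mm_def by (metis (no_types, lifting) mult_eq_0_iff sum.neutral)

lemma supported_diff [simp]: "supported A \<Longrightarrow> supported B \<Longrightarrow> supported (A - B)"
  by (simp add: supported_def)

lemma supported_add [simp]: "supported A \<Longrightarrow> supported B \<Longrightarrow> supported (A + B)"
  unfolding supported_def plus_fun_def by (metis add_0)

lemma mm_assoc: "A \<star> B \<star> C = A \<star> (B \<star> C)"
  unfolding mm_def sum_distrib_left sum_distrib_right
  by (subst sum.swap) (simp add: mult.assoc)

lemma mm_diff_left: "(A - B) \<star> C = A \<star> C - B \<star> C"
  by (auto simp: mm_def fun_eq_iff algebra_simps sum_subtractf)

lemma mm_diff_right: "A \<star> (B - C) = A \<star> B - A \<star> C"
  by (auto simp: mm_def fun_eq_iff algebra_simps sum_subtractf)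

lemma mm_add_left: "(A + B) \<star> C = A \<star> C + B \<star> C"
  by (auto simp: mm_def fun_eq_iff algebra_simps sum.distrib)

lemma mm_add_right: "A \<star> (B + C) = A \<star> B + A \<star> C"
  by (auto simp: mm_def fun_eq_iff algebra_simps sum.distrib)

definition diag :: "(idx \<Rightarrow> real) \<Rightarrow> imat" where
  "diag h = restr (\<lambda>i j. if i = j then h j else 0)"

lemma supported_diag [simp]: "supported (diag h)"
  by (simp add: diag_def)

lemma diag_mm: "supported A \<Longrightarrow> (diag h \<star> A) i j = h i * A i j"
  unfolding mm_def using supportedD[of A i j]
  by (subst sum_one[where x = i]) (auto simp: diag_def restr_def)

lemma mm_diag: "supported A \<Longrightarrow> (A \<star> diag h) i j = A i j * h j"
  unfolding mm_def using supportedD[of A i j]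
  by (subst sum_one[where x = j]) (auto simp: diag_def restr_def)

section \<open>Root vectors as matrices, with the source pattern as column and the target as
  row\<close>

definition e12m :: imat where
  "e12m = restr (\<lambda>i (a, b, c). if i = (a, b, c - 1) then of_int ((c - a) * (b - c)) else 0)"

definition e21m :: imat where
  "e21m = restr (\<lambda>i (a, b, c). if i = (a, b, c + 1) then 1 else 0)"

definition e13m :: imat where
  "e13m = restr (\<lambda>i (a, b, c).
     if i = (a - 1, b, c - 1) then of_int (a * (b - c)) / of_int (b - a)
     else if i = (a, b - 1, c - 1) then - (of_int (b * (c - a)) / of_int (b - a)) else 0)"

definition e31m :: imat where
  "e31m = restr (\<lambda>i (a, b, c).
     if i = (a + 1, b, c + 1) then of_int ((p - a) * (P - a)) / of_int (b - a)
     else if i = (a, b + 1, c + 1) then - (of_int ((b - p) * (P - b)) / of_int (b - a)) else 0)"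

lemma supported_e [simp]: "supported e12m" "supported e21m" "supported e13m" "supported e31m"
  by (simp_all add: e12m_def e21m_def e13m_def e31m_def)

lemma e13m_eq_0: "i \<noteq> (a - 1, b, c - 1) \<Longrightarrow> i \<noteq> (a, b - 1, c - 1) \<Longrightarrow> e13m i (a, b, c) = 0"
  by (simp add: e13m_def restr_def)

lemma e31m_eq_0: "i \<noteq> (a + 1, b, c + 1) \<Longrightarrow> i \<noteq> (a, b + 1, c + 1) \<Longrightarrow> e31m i (a, b, c) = 0"
  by (simp add: e31m_def restr_def)

lemma diag_eq_0: "i \<noteq> j \<Longrightarrow> diag h i j = 0"
  by (simp add: diag_def restr_def)

context
  fixes A :: imat assumes A: "supported A"
begin

text \<open>A supported \<open>A\<close> vanishes at indices outside \<open>pats\<close>, so this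
  formula and those that follow need no case distinction at the walls.\<close>

lemma mm_e12:
  "(a, b, c) \<in> pats \<Longrightarrow> (A \<star> e12m) i (a, b, c) = of_int ((c - a) * (b - c)) * A i (a, b, c - 1)"
  using supportedD[OF A, of i "(a, b, c - 1)"] unfolding mm_def
  by (subst sum_one[where x = "(a, b, c - 1)"]) (auto simp: e12m_def restr_def)

lemma mm_e21:
  "(a, b, c) \<in> pats \<Longrightarrow> (A \<star> e21m) i (a, b, c) = A i (a, b, c + 1)"
  using supportedD[OF A, of i "(a, b, c + 1)"] unfolding mm_def
  by (subst sum_one[where x = "(a, b, c + 1)"]) (auto simp: e21m_def restr_def)

lemma mm_e13:
  "(a, b, c) \<in> pats \<Longrightarrow> (A \<star> e13m) i (a, b, c) =
     of_int (a * (b - c)) / of_int (b - a) * A i (a - 1, b, c - 1)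
     - of_int (b * (c - a)) / of_int (b - a) * A i (a, b - 1, c - 1)"
  using supportedD[OF A, of i "(a - 1, b, c - 1)"] supportedD[OF A, of i "(a, b - 1, c - 1)"]
  unfolding mm_def
  by (subst sum_two[where x = "(a - 1, b, c - 1)" and y = "(a, b - 1, c - 1)"])
     (auto simp: e13m_def restr_def mult.commute simp del: of_int_mult of_int_diff)

lemma mm_e31:
  "(a, b, c) \<in> pats \<Longrightarrow> (A \<star> e31m) i (a, b, c) =
     of_int ((p - a) * (P - a)) / of_int (b - a) * A i (a + 1, b, c + 1)
     - of_int ((b - p) * (P - b)) / of_int (b - a) * A i (a, b + 1, c + 1)"
  using supportedD[OF A, of i "(a + 1, b, c + 1)"] supportedD[OF A, of i "(a, b + 1, c + 1)"]
  unfolding mm_def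
  by (subst sum_two[where x = "(a + 1, b, c + 1)" and y = "(a, b + 1, c + 1)"])
     (auto simp: e31m_def restr_def mult.commute simp del: of_int_mult of_int_diff)

lemma e12_mm:
  "(a, b, c) \<in> pats \<Longrightarrow> (e12m \<star> A) (a, b, c) j = of_int ((c + 1 - a) * (b - c - 1)) * A (a, b, c + 1) j"
  using supportedD[OF A, of "(a, b, c + 1)" j] unfolding mm_def
  by (subst sum_one[where x = "(a, b, c + 1)"]) (auto simp: e12m_def restr_def split: if_splits)

lemma e21_mm:
  "(a, b, c) \<in> pats \<Longrightarrow> (e21m \<star> A) (a, b, c) j = A (a, b, c - 1) j"
  using supportedD[OF A, of "(a, b, c - 1)" j] unfolding mm_def
  by (subst sum_one[where x = "(a, b, c - 1)"]) (auto simp: e21m_def restr_def split: if_splits)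

end

lemma mm_outside: "supported A \<Longrightarrow> supported B \<Longrightarrow> i \<notin> pats \<or> j \<notin> pats \<Longrightarrow> (A \<star> B) i j = 0"
  by (rule supportedD) simp_all

lemma ext_pats:
  assumes "supported A" "supported B" "\<And>i j. i \<in> pats \<Longrightarrow> j \<in> pats \<Longrightarrow> A i j = B i j"
  shows "A = B"
proof (intro ext)
  fix i j show "A i j = B i j"
    using assms supportedD[of A i j] supportedD[of B i j] by (cases "i \<in> pats \<and> j \<in> pats") auto
qed

text \<open>\<open>h12\<close> and \<open>h13\<close> are the eigenvalues of e11 - e22 and e11 - e33
  on a basis vector. The constant p + P in \<open>h13\<close> comes from the trace condition, which
  makes three times the first highest weight entry equal to p + P - 1.\<close>

definition h12 :: "idx \<Rightarrow> real" where "h12 = (\<lambda>(a, b, c). of_int (a + b - 1 - 2 * c))"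
definition h13 :: "idx \<Rightarrow> real" where "h13 = (\<lambda>(a, b, c). of_int (p + P - a - b - c))"

lemma comm_e12_e21: "e12m \<star> e21m = e21m \<star> e12m + diag h12"
proof (rule ext_pats)
  fix i j assume ij: "i \<in> pats" "j \<in> pats"
  obtain a b c where j: "j = (a, b, c)" by (cases j) auto
  have "c = b - 1 \<or> c + 1 < b" "c = a \<or> a < c" using ij by (auto simp: j)
  then show "(e12m \<star> e21m) i j = (e21m \<star> e12m + diag h12) i j"
    using ij unfolding j
    by (cases i, simp only: mm_e21 mm_e12 supported_e plus_fun_def)
      (elim disjE; auto simp: e12m_def e21m_def diag_def restr_def h12_def algebra_simps)
qed simp_all

lemma comm_e12_e13: "e12m \<star> e13m = e13m \<star> e12m"
proof (rule ext_pats)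
  fix i j assume ij: "i \<in> pats" "j \<in> pats"
  obtain a b c where j: "j = (a, b, c)" by (cases j) auto
  consider "i = (a - 1, b, c - 2)" | "i = (a, b - 1, c - 2)"
    | "i \<noteq> (a - 1, b, c - 2)" "i \<noteq> (a, b - 1, c - 2)" by blast
  then show "(e12m \<star> e13m) i j = (e13m \<star> e12m) i j"
  proof cases
    case 1
    then show ?thesis
      using ij unfolding j
      by (simp add: mm_e13 mm_e12) (simp add: e12m_def e13m_def restr_def)
  next
    case 2
    then show ?thesis
      using ij unfolding j
      by (simp add: mm_e13 mm_e12) (simp add: e12m_def e13m_def restr_def)
  next
    case 3
    then show ?thesis
      using ij unfolding j
      by (cases i, simp only: mm_e13 mm_e12 supported_e)
        (auto simp: e12m_def e13m_def restr_def)
  qed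
qed simp_all

lemma comm_e31_e21: "e31m \<star> e21m = e21m \<star> e31m"
proof (rule ext_pats)
  fix i j assume ij: "i \<in> pats" "j \<in> pats"
  obtain a b c where j: "j = (a, b, c)" by (cases j) auto
  show "(e31m \<star> e21m) i j = (e21m \<star> e31m) i j"
    using ij unfolding j
    by (cases i, simp only: mm_e31 mm_e21 supported_e)
      (auto simp: e21m_def e31m_def restr_def)
qed simp_all

lemma comm_e13_e31: "e13m \<star> e31m = e31m \<star> e13m + diag h13"
proof (rule ext_pats)
  fix i j assume ij: "i \<in> pats" "j \<in> pats"
  obtain a b c where j: "j = (a, b, c)" by (cases j) auto
  consider "i = (a, b, c)" | "i = (a + 1, b - 1, c)" | "i = (a - 1, b + 1, c)"
    | "i \<noteq> (a, b, c)" "i \<noteq> (a + 1, b - 1, c)" "i \<noteq> (a - 1, b + 1, c)" by blast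
  then show "(e13m \<star> e31m) i j = (e31m \<star> e13m + diag h13) i j"
  proof cases
    case 1
    define C where "C = (real_of_int p - of_int a) * (of_int P - of_int a) / (of_int b - of_int a) * ((of_int a + 1) * (of_int b - (of_int c + 1)) / (of_int b - (of_int a + 1)))
    + (of_int b - of_int p) * (of_int P - of_int b) / (of_int b - of_int a) * ((of_int b + 1) * (of_int c + 1 - of_int a) / (of_int b + 1 - of_int a))"
    define D where "D = real_of_int a * (of_int b - of_int c) / (of_int b - of_int a) * ((of_int p - (of_int a - 1)) * (of_int P - (of_int a - 1)) / (of_int b - (of_int a - 1)))
    + of_int b * (of_int c - of_int a) / (of_int b - of_int a) * ((of_int b - 1 - of_int p) * (of_int P - (of_int b - 1)) / (of_int b - 1 - of_int a))"
    have "a < b" using ij by (auto simp: j)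
    have 2: "C = D + of_int (p + P - a - b - c)" if "b \<noteq> a + 1"
    proof -
      have "real_of_int b \<noteq> of_int a" "real_of_int b \<noteq> of_int a + 1" "real_of_int b \<noteq> of_int a - 1"
        using that \<open>a < b\<close> by linarith+
      from comm_e13_e31_diag[OF this] show ?thesis unfolding C_def D_def by simp
    qed
    \<comment> \<open>Since a \<le> p < b, this case occurs only at a = c = p. The quotients with
      denominator zero then carry a factor p - a or c - a, which is zero as well.\<close>
    have 3: "C = D + of_int (p + P - a - b - c)" if "b = a + 1"
    proof -
      have "a = p" "b = p + 1" "c = p" using that ij by (auto simp: j)
      then show ?thesis by (simp add: C_def D_def field_simps)
    qed
    \<comment> \<open>At each of the three walls an intermediate pattern leaves the polytope, and
      the corresponding summand of \<open>C\<close> contains a factor that is zero there.\<close>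
    have "(e13m \<star> e31m) i j = C"
      using ij unfolding j 1 C_def
      by (simp only: mm_e31 supported_e, cases "a = p"; cases "c = b - 1"; cases "b = P"; simp add: e13m_def restr_def)
    moreover have "(e31m \<star> e13m + diag h13) i j = D + of_int (p + P - a - b - c)"
      using ij unfolding j 1 D_def plus_fun_def
      by (simp only: mm_e13 supported_e, cases "a = 0"; cases "c = a"; cases "b = p + 1"; simp add: e31m_def diag_def restr_def h13_def)
    ultimately show ?thesis using 2 3 by metis
  next
    case 2
    then show ?thesis
      using ij unfolding j
      by (simp add: mm_e31 mm_e13 plus_fun_def)
        (simp add: e13m_def e31m_def diag_def restr_def diff_diff_eq add.commute)
  next
    case 3
    then show ?thesis
      using ij unfolding j
      by (simp add: mm_e31 mm_e13 plus_fun_def)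
        (simp add: e13m_def e31m_def diag_def restr_def diff_diff_eq2 add.commute)
  next
    case 4
    then show ?thesis
      using ij unfolding j
      by (simp add: mm_e31 mm_e13 plus_fun_def e13m_eq_0 e31m_eq_0 diag_eq_0 del: mem_pats)
  qed
qed simp_all

section \<open>The involution with Racah entries\<close>

text \<open>
  \<open>racah_sum\<close> is \<open>c!\<close> times the terminating Saalschuetzian 4F3 series with upper parameters
  \<open>-a, -b, -a', -b'\<close> and lower parameters \<open>-p, -P, -c\<close>, and \<open>weyl_scale (a, b, c)\<close> is the paper's
  \<open>t(\<lambda>\<^sub>2\<^sub>1, \<lambda>\<^sub>1\<^sub>1, \<lambda>\<^sub>2\<^sub>2)\<close> divided by \<open>c!\<close>. Moving the \<open>c!\<close> to the sum makes the scale the inverse of the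
  contravariant form, see \<open>e12_sym\<close> and \<open>e13_sym\<close>.
\<close>

definition racah_sum :: "int \<Rightarrow> int \<Rightarrow> int \<Rightarrow> int \<Rightarrow> int \<Rightarrow> real" where
  "racah_sum a b a' b' c = (\<Sum>k\<le>nat p. (- 1) ^ k * poch a k * poch b k * poch a' k * poch b' k
     * ifac (c - int k) / (fact k * poch p k * poch P k))"

definition weyl_scale :: "idx \<Rightarrow> real" where
  "weyl_scale = (\<lambda>(a, b, c). of_int (b - a) * ifac p * ifac P * ifac (b - 1 - p) * ifac (b - 1 - c)
     / (ifac (p - a) * ifac (P - a) * ifac (c - a) * ifac b * ifac a * ifac (P - b)))"

text \<open>The condition on c says that the e22-weight of the source is the e33-weight of the
  target, while c' = c preserves the e11-weight. It is also what balances the 4F3 series. The sign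
  is symmetric in b and b' and absorbs the minus sign in the second coefficient of
  \<open>e13m\<close>.\<close>

definition weyl :: imat where
  "weyl = restr (\<lambda>(a', b', c') (a, b, c).
     if c' = c \<and> c = a + b + a' + b' - p - P - 1
     then (- 1) ^ nat (b + b') * (weyl_scale (a', b', c) * racah_sum a b a' b' c) else 0)"

lemma supported_weyl [simp]: "supported weyl"
  by (simp add: weyl_def)

lemma racah_sum_commute: "racah_sum a b a' b' c = racah_sum a' b' a b c"
  by (simp add: racah_sum_def mult_ac)

lemma poch_eq_0: "0 \<le> a \<Longrightarrow> a < int k \<Longrightarrow> poch a k = 0"
  by (auto simp: pochhammer_eq_0_iff intro!: exI[of _ "nat a"])

lemma poch_nonzero: "int k \<le> a \<Longrightarrow> poch a k \<noteq> 0"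
  by (auto simp: pochhammer_eq_0_iff)

text \<open>The identity holds termwise: (a - k)(b - c) + (b - k)(c - a) = (b - a)(c - k), and the
  factor c - k completes the factorial of c - 1 - k. The bound a' < c keeps the factorial arguments
  in range: terms with k > a' vanish.\<close>

lemma racah_sum_rec:
  assumes "0 \<le> a'" "a' < c"
  shows "of_int (a * (b - c)) * racah_sum (a - 1) b a' b' (c - 1) + of_int (b * (c - a)) * racah_sum a (b - 1) a' b' (c - 1)
     = of_int (b - a) * racah_sum a b a' b' c"
  unfolding racah_sum_def sum_distrib_left sum.distrib[symmetric]
proof (rule sum.cong)
  fix k
  show "of_int (a * (b - c)) * ((- 1) ^ k * poch (a - 1) k * poch b k * poch a' k * poch b' k
           * ifac (c - 1 - int k) / (fact k * poch p k * poch P k))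
      + of_int (b * (c - a)) * ((- 1) ^ k * poch a k * poch (b - 1) k * poch a' k * poch b' k
           * ifac (c - 1 - int k) / (fact k * poch p k * poch P k))
      = of_int (b - a) * ((- 1) ^ k * poch a k * poch b k * poch a' k * poch b' k
           * ifac (c - int k) / (fact k * poch p k * poch P k))"
  proof (cases "int k \<le> a'")
    case True
    then have c: "ifac (c - int k) = of_int (c - int k) * ifac (c - 1 - int k)"
      using assms ifac_rec[of "c - int k"] by (simp add: algebra_simps)
    define Q where "Q = (- 1) ^ k * poch a' k * poch b' k * ifac (c - 1 - int k) / (fact k * poch p k * poch P k)"
    have gen: "x * y * (s * A' * B * C * D * F / G) + z * w * (s * A * B' * C * D * F / G)
        = ((x * A') * (y * B) + (z * B') * (w * A)) * (s * C * D * F / G)"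
      for x y z w s A B A' B' C D F G :: real
      by (simp add: add_divide_distrib algebra_simps)
    have *: "of_int a * poch (a - 1) k = (of_int a - of_nat k) * poch a k" for a
      using pochhammer_minus_shift[of a k] by simp
    have "of_int (a * (b - c)) * ((- 1) ^ k * poch (a - 1) k * poch b k * poch a' k * poch b' k
           * ifac (c - 1 - int k) / (fact k * poch p k * poch P k))
      + of_int (b * (c - a)) * ((- 1) ^ k * poch a k * poch (b - 1) k * poch a' k * poch b' k
           * ifac (c - 1 - int k) / (fact k * poch p k * poch P k))
      = ((of_int a * poch (a - 1) k) * (of_int (b - c) * poch b k)
         + (of_int b * poch (b - 1) k) * (of_int (c - a) * poch a k)) * Q"
      unfolding Q_def of_int_mult by (rule gen)
    also have "\<dots> = of_int (b - a) * of_int (c - int k) * poch a k * poch b k * Q"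
      unfolding * by (simp add: algebra_simps)
    also have "\<dots> = of_int (b - a) * ((- 1) ^ k * poch a k * poch b k * poch a' k * poch b' k
           * ifac (c - int k) / (fact k * poch p k * poch P k))"
      unfolding Q_def c by (simp only: times_divide_eq_right mult_ac)
    finally show ?thesis .
  qed (use assms in \<open>simp add: poch_eq_0\<close>)
qed simp

lemma ifac_poch: "int k \<le> c \<Longrightarrow> (- 1) ^ k * ifac (c - int k) = ifac c / poch c k"
proof (induction k)
  case (Suc k)
  define x :: real where "x = of_int (c - int k)"
  have "x \<noteq> 0" using Suc.prems by (simp add: x_def)
  moreover have "ifac (c - int k) = x * ifac (c - int (Suc k))"
    using ifac_rec[of "c - int k"] Suc.prems by (simp add: x_def algebra_simps)
  moreover have "poch c (Suc k) = - x * poch c k"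
    by (simp add: pochhammer_Suc x_def)
  ultimately show ?case
    using Suc.IH Suc.prems poch_nonzero[of k c] by (simp add: field_simps)
qed simp

lemma racah_sum_upto:
  assumes "0 \<le> n" "n \<le> p" "n \<in> {a, b, a', b'}"
  shows "racah_sum a b a' b' c = (\<Sum>k\<le>nat n. (- 1) ^ k * poch a k * poch b k * poch a' k * poch b' k
     * ifac (c - int k) / (fact k * poch p k * poch P k))"
  unfolding racah_sum_def
proof (rule sum.mono_neutral_right)
  show "\<forall>i\<in>{..nat p} - {..nat n}. (- 1) ^ i * poch a i * poch b i * poch a' i * poch b' i
     * ifac (c - int i) / (fact i * poch p i * poch P i) = 0"
    using assms poch_eq_0[of n] by auto
qed (use assms in auto)

text \<open>
  These sums are the coefficients that the termwise relation would attach to vectors outside the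
  pattern polytope, at the walls \<open>b = p + 1\<close> and \<open>c = b'\<close>.
\<close>

lemma racah_sum_eq_0_lower:
  assumes "0 \<le> a" "a \<le> p" "0 \<le> a'" "a' \<le> c" "a \<le> c" "0 \<le> b'" "b' \<le> P" "a + a' + b' = P + c + 1"
  shows "racah_sum a p a' b' c = 0"
proof -
  have gen: "s * A * B * C * D * F / (K * B * G) = A / K * (C / E) * (D / G) * H"
    if "B \<noteq> 0" "s * F = H / E" for s A B C D E F G H K :: real
  proof -
    have "s * A * B * C * D * F / (K * B * G) = (s * F) * (A * C * D) / (K * G)"
      using that(1) by (simp add: mult_ac)
    then show ?thesis unfolding that(2) by (simp add: mult_ac)
  qed
  \<comment> \<open>The entry \<open>p\<close> cancels the lower parameter of the same value. The
    remaining 3F2 vanishes because (c - a') + (P - b') = a - 1.\<close>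
  have "racah_sum a p a' b' c = (\<Sum>k\<le>nat a. poch a k / fact k * (poch a' k / poch c k) * (poch b' k / poch P k)) * ifac c"
    unfolding racah_sum_upto[OF assms(1,2) insertI1] sum_distrib_right
  proof (rule sum.cong)
    fix k assume "k \<in> {..nat a}"
    then have k: "int k \<le> a" using assms by auto
    have "poch p k \<noteq> 0" using k assms by (intro poch_nonzero) auto
    moreover have "(- 1) ^ k * ifac (c - int k) = ifac c / poch c k"
      using k assms by (intro ifac_poch) auto
    ultimately show "(- 1) ^ k * poch a k * poch p k * poch a' k * poch b' k
     * ifac (c - int k) / (fact k * poch p k * poch P k)
      = poch a k / fact k * (poch a' k / poch c k) * (poch b' k / poch P k) * ifac c"
      by (rule gen)
  qed simp
  also have "\<dots> = 0"
    using assms p_less by (subst saalschuetz_vanishing) auto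
  finally show ?thesis .
qed

lemma racah_sum_eq_0_upper:
  assumes "0 \<le> a" "a \<le> p" "0 \<le> a'" "a' \<le> p" "0 \<le> b" "b \<le> P" "p \<le> b'" "a + a' + b = p + P + 1"
  shows "racah_sum a b a' b' b' = 0"
proof -
  have gen: "s * A * B * C * D * F / (K * E * G) = C / K * (A / E) * (B / G) * H"
    if "D \<noteq> 0" "s * F = H / D" for s A B C D E F G H K :: real
  proof -
    have "s * A * B * C * D * F / (K * E * G) = (s * F * D) * (A * B * C) / (K * E * G)"
      by (simp add: mult_ac)
    also have "s * F * D = H" using that by (simp add: field_simps)
    finally show ?thesis by (simp add: mult_ac)
  qed
  \<comment> \<open>Here \<open>b'\<close> cancels the third lower parameter, and (p - a) + (P - b)
    = a' - 1.\<close>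
  have "racah_sum a b a' b' b' = (\<Sum>k\<le>nat a'. poch a' k / fact k * (poch a k / poch p k) * (poch b k / poch P k)) * ifac b'"
    unfolding racah_sum_upto[OF assms(3,4) insertI2[OF insertI2[OF insertI1]]] sum_distrib_right
  proof (rule sum.cong)
    fix k assume "k \<in> {..nat a'}"
    then have k: "int k \<le> a'" using assms by auto
    have "poch b' k \<noteq> 0" using k assms by (intro poch_nonzero) auto
    moreover have "(- 1) ^ k * ifac (b' - int k) = ifac b' / poch b' k"
      using k assms by (intro ifac_poch) auto
    ultimately show "(- 1) ^ k * poch a k * poch b k * poch a' k * poch b' k
     * ifac (b' - int k) / (fact k * poch p k * poch P k)
      = poch a' k / fact k * (poch a k / poch p k) * (poch b k / poch P k) * ifac b'"
      by (rule gen)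
  qed simp
  also have "\<dots> = 0"
    using assms p_less by (subst saalschuetz_vanishing) auto
  finally show ?thesis .
qed

lemma weyl_scale_nonzero: "i \<in> pats \<Longrightarrow> weyl_scale i \<noteq> 0"
  by (cases i) (auto simp: weyl_scale_def)

lemma weyl_scale_step_c:
  assumes "a < c" "c < b"
  shows "of_int ((c - a) * (b - c)) * weyl_scale (a, b, c) = weyl_scale (a, b, c - 1)"
proof -
  have gen: "(x * y) * (N * p' * P' * Q * A / (D * E * (x * B) * F * G * H)) = N * p' * P' * Q * (y * A) / (D * E * B * F * G * H)"
    if "x \<noteq> 0" for x y N p' P' Q A B D E F G H :: real
    using that by (simp add: mult_ac)
  have "ifac (c - a) = of_int (c - a) * ifac (c - 1 - a)" "ifac (b - 1 - (c - 1)) = of_int (b - c) * ifac (b - 1 - c)"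
    using ifac_rec[of "c - a"] ifac_rec[of "b - c"] assms by (simp_all add: algebra_simps)
  then show ?thesis
    unfolding weyl_scale_def prod.case of_int_mult using assms by (simp only:) (rule gen, simp)
qed

lemma weyl_entry:
  assumes "(a', b', c) \<in> pats" "(a, b, c) \<in> pats" "c = a + b + a' + b' - p - P - 1"
  shows "weyl (a', b', c) (a, b, c) = (- 1) ^ nat (b + b') * (weyl_scale (a', b', c) * racah_sum a b a' b' c)"
  unfolding weyl_def restr_def using assms by (simp del: mem_pats)

lemma weyl_eq_0:
  assumes "c' \<noteq> c \<or> c \<noteq> a + b + a' + b' - p - P - 1"
  shows "weyl (a', b', c') (a, b, c) = 0"
  unfolding weyl_def restr_def using assms by (auto simp del: mem_pats)

lemma weyl_e13: "weyl \<star> e13m = e12m \<star> weyl"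
proof (rule ext_pats)
  fix i j assume ij: "i \<in> pats" "j \<in> pats"
  obtain a b c where j: "j = (a, b, c)" by (cases j) auto
  obtain a' b' c' where i: "i = (a', b', c')" by (cases i) auto
  have ab: "real_of_int b - of_int a > 0" using ij by (auto simp: j)
  show "(weyl \<star> e13m) i j = (e12m \<star> weyl) i j"
  proof (cases "c' = c - 1 \<and> c = a + b + a' + b' - p - P - 1")
    case False
    then have "weyl (a', b', c') (a - 1, b, c - 1) = 0" "weyl (a', b', c') (a, b - 1, c - 1) = 0"
      "weyl (a', b', c' + 1) (a, b, c) = 0"
      by (auto intro!: weyl_eq_0)
    then show ?thesis using ij unfolding i j by (simp add: mm_e13 e12_mm del: mem_pats)
  next
    case True
    define s :: real where "s = (- 1) ^ nat (b + b') * weyl_scale (a', b', c - 1)"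
    have 1: "of_int (a * (b - c)) * weyl i (a - 1, b, c - 1) = of_int (a * (b - c)) * (s * racah_sum (a - 1) b a' b' (c - 1))"
    proof (cases "a = 0")
      case False
      then have "weyl (a', b', c - 1) (a - 1, b, c - 1)
          = (- 1) ^ nat (b + b') * (weyl_scale (a', b', c - 1) * racah_sum (a - 1) b a' b' (c - 1))"
        using ij True unfolding i j by (intro weyl_entry) auto
      then show ?thesis by (simp add: i True s_def)
    qed simp
    \<comment> \<open>At \<open>b = p + 1\<close> the target is no pattern although the coefficient
      may be nonzero; the Racah sum vanishes instead.\<close>
    have 2: "of_int (b * (c - a)) * weyl i (a, b - 1, c - 1) = - of_int (b * (c - a)) * (s * racah_sum a (b - 1) a' b' (c - 1))"
    proof -
      consider "c = a" | "c \<noteq> a" "b = p + 1" | "c \<noteq> a" "b \<noteq> p + 1" by blast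
      then show ?thesis
      proof cases
        case 2
        then have "racah_sum a p a' b' (c - 1) = 0"
          using ij True unfolding i j by (intro racah_sum_eq_0_lower) auto
        moreover have "weyl i (a, b - 1, c - 1) = 0"
          using 2 by (intro supportedD supported_weyl) auto
        ultimately show ?thesis using 2 by simp
      next
        case 3
        then have "weyl (a', b', c - 1) (a, b - 1, c - 1)
            = (- 1) ^ nat (b - 1 + b') * (weyl_scale (a', b', c - 1) * racah_sum a (b - 1) a' b' (c - 1))"
          using ij True unfolding i j by (intro weyl_entry) auto
        moreover have "nat (b + b') = Suc (nat (b - 1 + b'))"
          using ij p_nonneg unfolding i j by auto
        ultimately show ?thesis by (simp add: i True s_def)
      qed simp
    qed
    \<comment> \<open>At \<open>c = b'\<close> the left side is zero because of the factor b' - c,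
      so the Racah sum on the right has to vanish.\<close>
    have 3: "of_int ((c - a') * (b' - c)) * weyl (a', b', c) j = s * racah_sum a b a' b' c"
    proof (cases "c = b'")
      case True': True
      then have "racah_sum a b a' b' c = 0"
        using ij True unfolding i j True' by (intro racah_sum_eq_0_upper) auto
      then show ?thesis by (simp add: True')
    next
      case False
      then have "weyl (a', b', c) j = (- 1) ^ nat (b + b') * (weyl_scale (a', b', c) * racah_sum a b a' b' c)"
        using ij True unfolding i j by (intro weyl_entry) auto
      moreover have "of_int ((c - a') * (b' - c)) * weyl_scale (a', b', c) = weyl_scale (a', b', c - 1)"
        using ij True False unfolding i j by (intro weyl_scale_step_c) auto
      ultimately show ?thesis by (simp add: s_def mult_ac)
    qed
    have 4: "of_int (a * (b - c)) * racah_sum (a - 1) b a' b' (c - 1) + of_int (b * (c - a)) * racah_sum a (b - 1) a' b' (c - 1)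
     = of_int (b - a) * racah_sum a b a' b' c"
      using ij True unfolding i j by (intro racah_sum_rec) auto
    have "(weyl \<star> e13m) i j = (of_int (a * (b - c)) * weyl i (a - 1, b, c - 1)
       - of_int (b * (c - a)) * weyl i (a, b - 1, c - 1)) / of_int (b - a)"
      using ij unfolding j by (simp add: mm_e13 diff_divide_distrib del: mem_pats)
    also have "\<dots> = s * (of_int (a * (b - c)) * racah_sum (a - 1) b a' b' (c - 1) + of_int (b * (c - a)) * racah_sum a (b - 1) a' b' (c - 1)) / of_int (b - a)"
      unfolding 1 2 by (simp only: mult_minus_left mult_minus_right diff_minus_eq_add distrib_left mult_ac)
    also have "\<dots> = s * racah_sum a b a' b' c"
      unfolding 4 using ab by simp
    also have "\<dots> = (e12m \<star> weyl) i j"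
      using ij 3 conjunct1[OF True] unfolding i by (simp add: e12_mm del: mem_pats of_int_mult of_int_diff)
    finally show ?thesis .
  qed
qed simp_all

text \<open>In the contravariant form the basis is orthogonal with squared norms 1 /
  \<open>weyl_scale\<close>. W is self-adjoint because the sum, the sign and the weight condition do
  not change when the two patterns are exchanged.\<close>

lemma weyl_sym: "weyl_scale j * weyl i j = weyl_scale i * weyl j i"
  by (cases i; cases j) (auto simp: weyl_def restr_def racah_sum_commute add_ac)

lemma e12_sym: "e12m i j * weyl_scale j = weyl_scale i * e21m j i"
  using weyl_scale_step_c by (cases i; cases j) (auto simp: e12m_def e21m_def restr_def)

lemma e13_sym: "e13m i j * weyl_scale j = weyl_scale i * e31m j i"
proof (cases "i \<in> pats \<and> j \<in> pats")
  case False
  then show ?thesis by (auto simp: supportedD)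
next
  case True
  obtain a b c where j: "j = (a, b, c)" by (cases j) auto
  consider "i = (a - 1, b, c - 1)" | "i = (a, b - 1, c - 1)" | "i \<noteq> (a - 1, b, c - 1)" "i \<noteq> (a, b - 1, c - 1)"
    by blast
  then show ?thesis
  proof cases
    case 1
    have gen: "x * y / d * (d * p' * P' * Q * A / (B * C * D * E * (x * F) * G))
      = d' * p' * P' * Q * (y * A) / ((u * B) * (v * C) * D * E * F * G) * (u * v / d')"
      if "x \<noteq> 0" "d \<noteq> 0" "d' \<noteq> 0" "u \<noteq> 0" "v \<noteq> 0" for x y d d' u v p' P' A B C D E F G Q :: real
      using that by simp
    have r: "ifac (p - (a - 1)) = of_int (p - (a - 1)) * ifac (p - a)" "ifac (P - (a - 1)) = of_int (P - (a - 1)) * ifac (P - a)"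
       "ifac a = of_int a * ifac (a - 1)" "ifac (b - 1 - (c - 1)) = of_int (b - c) * ifac (b - 1 - c)" "c - 1 - (a - 1) = c - a"
      using True ifac_rec[of "p - (a - 1)"] ifac_rec[of "P - (a - 1)"] ifac_rec[of a] ifac_rec[of "b - c"]
      unfolding j 1 by (auto simp: algebra_simps)
    have "e13m i j = of_int a * of_int (b - c) / of_int (b - a)"
      "e31m j i = of_int (p - (a - 1)) * of_int (P - (a - 1)) / of_int (b - (a - 1))"
      using True unfolding j 1 by (simp_all add: e13m_def e31m_def restr_def)
    then show ?thesis
      unfolding j 1 weyl_scale_def prod.case r
      using True unfolding j 1 by (simp only:) (rule gen, auto)
  next
    case 2
    have gen: "- (x * y / d) * (d * p' * P' * (u * Q) * A / (B * C * (y * D) * (x * E) * F * G))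
      = d' * p' * P' * Q * A / (B * C * D * E * F * (v * G)) * (- (u * v / d'))"
      if "x \<noteq> 0" "y \<noteq> 0" "d \<noteq> 0" "d' \<noteq> 0" "u \<noteq> 0" "v \<noteq> 0" for x y d d' u v p' P' A B C D E F G Q :: real
      using that by simp
    have r: "ifac (c - a) = of_int (c - a) * ifac (c - 1 - a)" "ifac (P - (b - 1)) = of_int (P - (b - 1)) * ifac (P - b)"
       "ifac b = of_int b * ifac (b - 1)" "ifac (b - 1 - p) = of_int (b - 1 - p) * ifac (b - 1 - 1 - p)"
       "b - 1 - 1 - (c - 1) = b - 1 - c"
      using True ifac_rec[of "c - a"] ifac_rec[of "P - (b - 1)"] ifac_rec[of b] ifac_rec[of "b - 1 - p"]
      unfolding j 2 by (auto simp: algebra_simps)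
    have "e13m i j = - (of_int b * of_int (c - a) / of_int (b - a))"
      "e31m j i = - (of_int (b - 1 - p) * of_int (P - (b - 1)) / of_int (b - 1 - a))"
      using True unfolding j 2 by (simp_all add: e13m_def e31m_def restr_def)
    then show ?thesis
      unfolding j 2 weyl_scale_def prod.case r
      using True unfolding j 2 by (simp only:) (rule gen, auto)
  next
    case 3
    then show ?thesis
      using True unfolding j by (cases i) (auto simp: e13m_def e31m_def restr_def)
  qed
qed

lemma weyl_e21: "weyl \<star> e21m = e31m \<star> weyl"
proof (rule ext_pats)
  fix i j assume ij: "i \<in> pats" "j \<in> pats"
  \<comment> \<open>Taking adjoints reverses a product; this is applied to both sides of
    \<open>weyl_e13\<close>.\<close>
  have tr: "(A \<star> B) i j = weyl_scale i / weyl_scale j * (B' \<star> A') j i"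
    if "\<And>k. k \<in> pats \<Longrightarrow> weyl_scale k * A i k = weyl_scale i * A' k i" "\<And>k. k \<in> pats \<Longrightarrow> weyl_scale j * B k j = weyl_scale k * B' j k"
    for A A' B B'
    unfolding mm_def sum_distrib_left
  proof (rule sum.cong)
    fix k assume k: "k \<in> pats"
    have "A i k = weyl_scale i * A' k i / weyl_scale k" "B k j = weyl_scale k * B' j k / weyl_scale j"
      using that[OF k] weyl_scale_nonzero[OF k] weyl_scale_nonzero[OF ij(2)] by (simp_all add: field_simps)
    then show "A i k * B k j = weyl_scale i / weyl_scale j * (B' j k * A' k i)"
      using weyl_scale_nonzero[OF k] by simp
  qed simp
  have "(weyl \<star> e21m) i j = weyl_scale i / weyl_scale j * (e12m \<star> weyl) j i"
    using weyl_sym e12_sym by (intro tr) (auto simp: mult.commute)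
  also have "\<dots> = weyl_scale i / weyl_scale j * (weyl \<star> e13m) j i"
    by (simp add: weyl_e13)
  also have "\<dots> = (e31m \<star> weyl) i j"
    using weyl_sym e13_sym by (intro tr[symmetric]) (auto simp: mult.commute)
  finally show "(weyl \<star> e21m) i j = (e31m \<star> weyl) i j" .
qed simp_all

text \<open>
  The basis vector \<open>(p, P, p)\<close> is cyclic for \<open>e21\<close> and \<open>e13\<close>: repeated \<open>e13\<close> gives all \<open>(a, P, a)\<close>, then \<open>e21\<close>
  raises \<open>c\<close>, and \<open>e13\<close> leads from \<open>b\<close> to \<open>b - 1\<close> modulo vectors already reached.
\<close>

lemma eq_0_if_lowest_column_eq_0:
  assumes X: "supported X" and X21: "X \<star> e21m = A \<star> X" and X13: "X \<star> e13m = B \<star> X"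
    and low: "\<And>i. X i (p, P, p) = 0"
  shows "X = 0"
proof -
  define Z where "Z a b c \<longleftrightarrow> (\<forall>i. X i (a, b, c) = 0)" for a b c
  have step21: "Z a b (c + 1)" if "Z a b c" "(a, b, c) \<in> pats" for a b c
    unfolding Z_def
  proof
    fix i
    have "X i (a, b, c + 1) = (A \<star> X) i (a, b, c)"
      using mm_e21[OF X that(2)] X21 by simp
    then show "X i (a, b, c + 1) = 0"
      using that(1) unfolding Z_def mm_def by (simp del: split_paired_All)
  qed
  have step13: "of_int (a * (b - c)) * X i (a - 1, b, c - 1) = of_int (b * (c - a)) * X i (a, b - 1, c - 1)"
    if "Z a b c" "(a, b, c) \<in> pats" for a b c i
  proof -
    have "real_of_int (b - a) \<noteq> 0" using that(2) by auto
    then show ?thesis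
      using fun_cong[OF fun_cong[OF X13], of i "(a, b, c)"] that
      by (simp add: Z_def mm_e13[OF X] mm_def[of B] divide_simps del: mem_pats of_int_mult of_int_diff split_paired_All)
  qed
  have up: "Z a b c" if "a \<le> c" "0 \<le> a" "a \<le> p" "p < b" "b \<le> P" "Z a b a" for a b c
    using that(1)
  proof (induction c rule: int_ge_induct)
    case (step c)
    show ?case
    proof (cases "c < b")
      case True
      then show ?thesis using step that by (intro step21) auto
    next
      case False
      then show ?thesis using supportedD[OF X] by (auto simp: Z_def)
    qed
  qed (use that in simp)
  \<comment> \<open>Along c = a the factor c - a removes the b - 1 term from \<open>step13\<close>,
    so vanishing passes from a to a - 1.\<close>
  have top: "Z a P a" if "a \<le> p" "0 \<le> a" for a
    using that
  proof (induction a rule: int_le_induct)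
    case base
    then show ?case using low by (simp add: Z_def)
  next
    case (step a)
    then have "Z a P a" "a * (P - a) \<noteq> 0" using p_less by auto
    then show ?case using step13[of a P a] step p_less by (auto simp: Z_def)
  qed
  have all: "Z a b c" if "b \<le> P" "p < b" "0 \<le> a" "a \<le> p" "a \<le> c" "c < b" for a b c
    using that
  proof (induction b arbitrary: a c rule: int_le_induct)
    case base
    then show ?case using up[of a c P] top[of a] p_less by simp
  next
    case (step b)
    have Z: "Z a b (c + 1)" using step.IH[of a "c + 1"] step.prems step.hyps by simp
    then have "of_int (a * (b - (c + 1))) * X i (a - 1, b, c) = of_int (b * (c + 1 - a)) * X i (a, b - 1, c)" for i
      using step13[of a b "c + 1" i] step.prems step.hyps by simp
    moreover have "of_int (a * (b - (c + 1))) * X i (a - 1, b, c) = 0" for i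
      using step.IH[of "a - 1" c] step.prems step.hyps by (cases "a = 0") (simp_all add: Z_def del: split_paired_All)
    moreover have "real_of_int (b * (c + 1 - a)) \<noteq> 0" using step.prems p_nonneg by auto
    ultimately have "X i (a, b - 1, c) = 0" for i by (metis mult_eq_0_iff)
    then show ?case by (simp add: Z_def)
  qed
  show ?thesis
  proof (intro ext)
    fix i j :: idx
    obtain a b c where "j = (a, b, c)" by (cases j) auto
    then show "X i j = 0 i j"
      using all[of b a c] supportedD[OF X, of i j] by (cases "j \<in> pats") (simp_all add: Z_def del: split_paired_All)
  qed
qed

section \<open>Relations of W deduced from the cyclic vector\<close>

lemma weyl_h12: "weyl \<star> diag h12 = diag h13 \<star> weyl"
  by (rule ext_pats; simp add: mm_diag diag_mm) (auto simp: weyl_def restr_def h12_def h13_def)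

lemma weyl_h13: "weyl \<star> diag h13 = diag h12 \<star> weyl"
  by (rule ext_pats; simp add: mm_diag diag_mm) (auto simp: weyl_def restr_def h12_def h13_def)

text \<open>The image weight is extremal with a one-dimensional weight space: a' + b' = p + 1
  together with a' \<ge> 0 and b' > p leaves a single pattern.\<close>

lemma weyl_low: "i \<noteq> (0, p + 1, p) \<Longrightarrow> weyl i (p, P, p) = 0"
  by (cases i) (auto simp: weyl_def restr_def)

text \<open>Moving \<open>e21\<close> through \<open>D\<close> with the bracket relations produces
  Cartan terms, which cancel because W exchanges \<open>h12\<close> and \<open>h13\<close>.\<close>

lemma weyl_e12: "weyl \<star> e12m = e13m \<star> weyl"
proof -
  define D where "D = weyl \<star> e12m - e13m \<star> weyl"
  have "D \<star> e21m = weyl \<star> e21m \<star> e12m + weyl \<star> diag h12 - (e13m \<star> e31m) \<star> weyl"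
    by (simp add: D_def mm_diff_left mm_assoc comm_e12_e21 mm_add_right weyl_e21)
      (simp add: weyl_e21 flip: mm_assoc)
  also have "\<dots> = e31m \<star> weyl \<star> e12m - (e31m \<star> e13m) \<star> weyl"
    by (simp add: weyl_e21 comm_e13_e31 mm_add_left weyl_h12)
  also have "\<dots> = e31m \<star> D"
    by (simp add: D_def mm_diff_right mm_assoc)
  finally have 1: "D \<star> e21m = e31m \<star> D" .
  have "D \<star> e13m = weyl \<star> e13m \<star> e12m - (e13m \<star> e12m) \<star> weyl"
    by (simp add: D_def mm_diff_left mm_assoc comm_e12_e13 weyl_e13)
      (simp add: weyl_e13 flip: mm_assoc)
  also have "\<dots> = e12m \<star> D"
    unfolding comm_e12_e13[symmetric] by (simp add: D_def mm_diff_right mm_assoc)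
      (simp add: weyl_e13 flip: mm_assoc)
  finally have 2: "D \<star> e13m = e12m \<star> D" .
  \<comment> \<open>\<open>e12\<close> kills the extremal vector since c = a there;
    \<open>e13\<close> kills its image under W since a = 0 and b - 1 = p is outside the range of
    b.\<close>
  have "D i (p, P, p) = 0" for i
  proof -
    have "(weyl \<star> e12m) i (p, P, p) = 0"
      using p_nonneg p_less by (simp add: mm_e12)
    moreover have "e13m i (0, p + 1, p) = 0" for i
      by (cases i) (auto simp: e13m_def restr_def)
    then have "(e13m \<star> weyl) i (p, P, p) = 0"
      unfolding mm_def using weyl_low by (intro sum.neutral) (metis mult_eq_0_iff)
    ultimately show ?thesis by (simp add: D_def)
  qed
  then have "D = 0"
    using 1 2 by (intro eq_0_if_lowest_column_eq_0) (simp_all add: D_def)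
  then show ?thesis by (simp add: D_def)
qed

lemma weyl_e31: "weyl \<star> e31m = e21m \<star> weyl"
proof -
  define D where "D = weyl \<star> e31m - e21m \<star> weyl"
  have "D \<star> e21m = weyl \<star> e21m \<star> e31m - (e21m \<star> e31m) \<star> weyl"
    by (simp add: D_def mm_diff_left mm_assoc comm_e31_e21 weyl_e21)
      (simp add: weyl_e21 flip: mm_assoc)
  also have "\<dots> = e31m \<star> D"
    unfolding comm_e31_e21[symmetric] by (simp add: D_def mm_diff_right mm_assoc weyl_e21)
  finally have 1: "D \<star> e21m = e31m \<star> D" .
  have "D \<star> e13m = weyl \<star> (e31m \<star> e13m) - (e21m \<star> e12m) \<star> weyl"
    by (simp add: D_def mm_diff_left mm_assoc weyl_e13)
  also have "\<dots> = weyl \<star> (e13m \<star> e31m - diag h13) - (e12m \<star> e21m - diag h12) \<star> weyl"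
    by (simp add: comm_e13_e31 comm_e12_e21)
  also have "\<dots> = e12m \<star> D"
    by (simp add: D_def mm_diff_right mm_diff_left mm_assoc[symmetric] weyl_e13 weyl_h13)
  finally have 2: "D \<star> e13m = e12m \<star> D" .
  have "D i (p, P, p) = 0" for i
  proof -
    have "(weyl \<star> e31m) i (p, P, p) = 0"
      using p_nonneg p_less by (simp add: mm_e31)
    moreover have "e21m i (0, p + 1, p) = 0" for i
      by (cases i) (auto simp: e21m_def restr_def)
    then have "(e21m \<star> weyl) i (p, P, p) = 0"
      unfolding mm_def using weyl_low by (intro sum.neutral) (metis mult_eq_0_iff)
    ultimately show ?thesis by (simp add: D_def)
  qed
  then have "D = 0"
    using 1 2 by (intro eq_0_if_lowest_column_eq_0) (simp_all add: D_def)
  then show ?thesis by (simp add: D_def)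
qed

lemma diag_1_mm: "supported A \<Longrightarrow> diag (\<lambda>_. 1) \<star> A = A"
  by (intro ext) (simp add: diag_mm)

lemma mm_diag_1: "supported A \<Longrightarrow> A \<star> diag (\<lambda>_. 1) = A"
  by (intro ext) (simp add: mm_diag)

lemma weyl_weyl: "weyl \<star> weyl = diag (\<lambda>_. 1)"
proof -
  define D where "D = weyl \<star> weyl - diag (\<lambda>_. 1)"
  have 1: "D \<star> e21m = e21m \<star> D"
    by (simp add: D_def mm_diff_left mm_diff_right diag_1_mm mm_diag_1 mm_assoc weyl_e21)
       (simp add: mm_assoc[symmetric] weyl_e31)
  have 2: "D \<star> e13m = e13m \<star> D"
    by (simp add: D_def mm_diff_left mm_diff_right diag_1_mm mm_diag_1 mm_assoc weyl_e13)
       (simp add: mm_assoc[symmetric] weyl_e12)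
  have "D i (p, P, p) = 0" for i
  proof -
    have l: "(0, p + 1, p) \<in> pats" "(p, P, p) \<in> pats" using p_nonneg p_less by auto
    have "(weyl \<star> weyl) i (p, P, p) = weyl i (0, p + 1, p) * weyl (0, p + 1, p) (p, P, p)"
      unfolding mm_def using l weyl_low by (subst sum_one[where x = "(0, p + 1, p)"]) auto
    \<comment> \<open>The intertwining relations determine W only up to a scalar. Here its
      normalization enters: the two scales and the two Racah sums, both equal to p!, multiply to
      1.\<close>
    also have "\<dots> = (if i = (p, P, p) then 1 else 0)"
    proof (cases "i = (p, P, p)")
      case True
      have "racah_sum 0 (p + 1) p P p = ifac p"
        using p_nonneg by (subst racah_sum_upto[of 0]) auto
      moreover have "racah_sum p P 0 (p + 1) p = ifac p"
        using p_nonneg by (subst racah_sum_upto[of 0]) auto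
      moreover have "ifac (P - p) = of_int (P - p) * ifac (P - 1 - p)"
        using ifac_rec[of "P - p"] p_less by (simp add: algebra_simps)
      then have "weyl_scale (p, P, p) = ifac (P - 1 - p)"
        using p_less by (simp add: weyl_scale_def)
      moreover have "ifac (p + 1) = of_int (p + 1) * ifac p"
        using ifac_rec[of "p + 1"] p_nonneg by simp
      then have "weyl_scale (0, p + 1, p) = 1 / (ifac p * ifac p * ifac (P - 1 - p))"
        using p_nonneg by (simp add: weyl_scale_def diff_diff_eq add.commute)
      ultimately show ?thesis
        using True l by (simp add: weyl_entry add.commute flip: power_add del: mem_pats)
    next
      case False
      then have "weyl i (0, p + 1, p) = 0"
        by (cases i) (auto simp: weyl_def restr_def)
      then show ?thesis using False by simp
    qed
    finally show ?thesis
      using l by (simp add: D_def diag_def restr_def)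
  qed
  then have "D = 0"
    using 1 2 by (intro eq_0_if_lowest_column_eq_0) (simp_all add: D_def)
  then show ?thesis by (simp add: D_def)
qed

end

section \<open>Rotations and Krawtchouk polynomials\<close>

text \<open>Differentiation in the angle is coefficientwise, so that powers of linear forms can be
  handled by the product rule before a coefficient is read off.\<close>

definition has_poly_derivative :: "(real \<Rightarrow> real poly) \<Rightarrow> real poly \<Rightarrow> real \<Rightarrow> bool" where
  "has_poly_derivative f f' t \<longleftrightarrow> (\<forall>n. ((\<lambda>s. coeff (f s) n) has_real_derivative coeff f' n) (at t))"

lemma has_poly_derivative_mult:
  assumes "has_poly_derivative f f' t" "has_poly_derivative g g' t"
  shows "has_poly_derivative (\<lambda>s. f s * g s) (f t * g' + f' * g t) t"
  unfolding has_poly_derivative_def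
proof
  fix n
  have "((\<lambda>s. \<Sum>i\<le>n. coeff (f s) i * coeff (g s) (n - i)) has_real_derivative
      (\<Sum>i\<le>n. coeff (f t) i * coeff g' (n - i) + coeff f' i * coeff (g t) (n - i))) (at t)"
    using assms unfolding has_poly_derivative_def
    by (intro DERIV_sum DERIV_mult') auto
  then show "((\<lambda>s. coeff (f s * g s) n) has_real_derivative coeff (f t * g' + f' * g t) n) (at t)"
    by (simp add: coeff_mult sum.distrib)
qed

lemma has_poly_derivative_power:
  assumes "has_poly_derivative f f' t"
  shows "has_poly_derivative (\<lambda>s. f s ^ k) (of_nat k * f t ^ (k - 1) * f') t"
proof (induction k)
  case 0
  then show ?case by (simp add: has_poly_derivative_def)
next
  case (Suc k)
  have "has_poly_derivative (\<lambda>s. f s * f s ^ k) (f t * (of_nat k * f t ^ (k - 1) * f') + f' * f t ^ k) t"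
    by (rule has_poly_derivative_mult[OF assms Suc])
  moreover have "f t * (of_nat k * f t ^ (k - 1) * f') + f' * f t ^ k = of_nat (Suc k) * f t ^ (Suc k - 1) * f'"
    by (cases k) (simp_all add: algebra_simps)
  ultimately show ?case by simp
qed

text \<open>A matrix coefficient on binary forms of degree \<open>N\<close>, with one variable set
  to 1. The first linear form has the opposite sign to a rotation, so that the Krawtchouk expansion
  has no sign; \<open>zrot\<close> takes the resulting power of -1 out again.\<close>

definition rot_coeff :: "nat \<Rightarrow> nat \<Rightarrow> nat \<Rightarrow> real \<Rightarrow> real" where
  "rot_coeff N n x t = coeff ([:sin t, - cos t:] ^ x * [:cos t, sin t:] ^ (N - x)) n"

text \<open>The two linear forms f and g satisfy f' = g and g' = -f, so differentiating a product of
  their powers moves one factor from one power to the other. Truncated subtraction at x = 0 or x = N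
  is harmless, because the term has the factor zero.\<close>

lemma rot_coeff_deriv:
  assumes "x \<le> N"
  shows "(rot_coeff N n x has_real_derivative
    real x * rot_coeff N n (x - 1) t - real (N - x) * rot_coeff N n (Suc x) t) (at t)"
proof -
  let ?f = "\<lambda>t :: real. [:sin t, - cos t:]" and ?g = "\<lambda>t :: real. [:cos t, sin t:]"
  have f: "has_poly_derivative ?f (?g t) t" and g: "has_poly_derivative ?g (- ?f t) t"
    unfolding has_poly_derivative_def
    by (auto simp: coeff_pCons split: nat.split intro!: derivative_eq_intros)
  have "has_poly_derivative (\<lambda>s. ?f s ^ x * ?g s ^ (N - x))
     (?f t ^ x * (of_nat (N - x) * ?g t ^ (N - x - 1) * (- ?f t))
      + (of_nat x * ?f t ^ (x - 1) * ?g t) * ?g t ^ (N - x)) t" (is "has_poly_derivative _ ?D t")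
    by (intro has_poly_derivative_mult has_poly_derivative_power f g)
  moreover have "?D = smult (real x) (?f t ^ (x - 1) * ?g t ^ (N - (x - 1)))
      - smult (real (N - x)) (?f t ^ Suc x * ?g t ^ (N - Suc x))"
  proof -
    have e: "of_nat m * q = smult (real m) q" for m and q :: "real poly"
      by (simp add: of_nat_poly)
    have 1: "(of_nat x * ?f t ^ (x - 1) * ?g t) * ?g t ^ (N - x) = smult (real x) (?f t ^ (x - 1) * ?g t ^ (N - (x - 1)))"
    proof (cases x)
      case (Suc y)
      then have "N - y = Suc (N - x)" using assms by simp
      then show ?thesis using Suc by (simp only: e[symmetric] diff_Suc_1 power_Suc mult_ac)
    qed simp
    have 2: "?f t ^ x * (of_nat (N - x) * ?g t ^ (N - x - 1) * (- ?f t))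
      = - smult (real (N - x)) (?f t ^ Suc x * ?g t ^ (N - Suc x))"
      by (simp only: e[symmetric] power_Suc mult_minus_right diff_diff_left Suc_eq_plus1[symmetric] mult_ac)
    show ?thesis unfolding 1 2 by simp
  qed
  ultimately show ?thesis
    by (simp only: has_poly_derivative_def rot_coeff_def[abs_def] coeff_diff coeff_smult)
qed

lemma rot_coeff_0:
  assumes "x \<le> N" "n \<le> N"
  shows "rot_coeff N n x 0 = (if n = x then (- 1) ^ x else 0)"
proof -
  have "[:sin 0, - cos 0:] = monom (-1 :: real) 1" "[:cos 0, sin 0:] = (1 :: real poly)"
    by (simp_all add: monom_altdef one_pCons)
  then show ?thesis
    by (simp only: rot_coeff_def monom_power power_one mult_1_right coeff_monom) auto
qed

lemma binomial_pochhammer_shift: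
  assumes "k \<le> n" "n \<le> N"
  shows "real ((N - k) choose (n - k)) = real (N choose n) * (pochhammer (- real n) k / pochhammer (- real N) k)"
proof -
  have "pochhammer (- real n) k = fact k * ((- 1) ^ k * real (n choose k))"
    "pochhammer (- real N) k = fact k * ((- 1) ^ k * real (N choose k))"
    using pochhammer_minus_nat[of k n] pochhammer_minus_nat[of k N] assms by (simp_all add: field_simps)
  moreover have "real (N choose n) * real (n choose k) = real (N choose k) * real ((N - k) choose (n - k))"
    using choose_mult[of k n N] assms by (metis of_nat_mult)
  ultimately show ?thesis using assms by (simp add: field_simps)
qed

text \<open>
  The sum comes from expanding \<open>sin t - cos t w = (sin t / cos t) (cos t + sin t w) - w / cos t\<close>.
\<close>

lemma rot_coeff_krawtchouk:
  assumes "x \<le> N" "n \<le> N" "sin t \<noteq> 0" "cos t \<noteq> 0"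
  shows "rot_coeff N n x t = real (N choose n) * cos t ^ N * tan t ^ (n + x) *
    (\<Sum>k\<le>min n x. pochhammer (- real n) k * pochhammer (- real x) k
       / (fact k * pochhammer (- real N) k) * (1 / (sin t)\<^sup>2) ^ k)"
proof -
  define s c where "s = sin t" and "c = cos t"
  have nz: "s \<noteq> 0" "c \<noteq> 0" using assms by (simp_all add: s_def c_def)
  have sc: "s * s + c * c = 1" by (simp add: s_def c_def flip: power2_eq_square)
  define Q where "Q = [:c, s:]"
  have P: "[:s, - c:] = monom (- 1 / c) 1 + smult (s / c) Q"
    using nz sc by (simp add: Q_def monom_altdef field_simps)
  have coeffQ: "coeff (Q ^ m) r = of_nat (m choose r) * s ^ r * c ^ (m - r)" if "r \<le> m" for m r
    unfolding Q_def using that by (rule coeff_linear_poly_power)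
  have "[:s, - c:] ^ x * Q ^ (N - x) = (\<Sum>k\<le>x. of_nat (x choose k) * monom (- 1 / c) 1 ^ k * smult (s / c) Q ^ (x - k)) * Q ^ (N - x)"
    unfolding P by (subst binomial_ring) simp
  also have "\<dots> = (\<Sum>k\<le>x. smult (of_nat (x choose k) * (s / c) ^ (x - k)) (monom ((- 1 / c) ^ k) k * Q ^ (N - k)))"
    unfolding sum_distrib_right
  proof (rule sum.cong)
    fix k assume "k \<in> {..x}"
    then have "Q ^ (N - k) = Q ^ (x - k) * Q ^ (N - x)" using assms by (simp flip: power_add)
    then show "of_nat (x choose k) * monom (- 1 / c) 1 ^ k * smult (s / c) Q ^ (x - k) * Q ^ (N - x)
        = smult (of_nat (x choose k) * (s / c) ^ (x - k)) (monom ((- 1 / c) ^ k) k * Q ^ (N - k))"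
      by (simp add: monom_power smult_power of_nat_poly mult_ac)
  qed simp
  finally have "rot_coeff N n x t = (\<Sum>k\<le>x. of_nat (x choose k) * (s / c) ^ (x - k) * coeff (monom ((- 1 / c) ^ k) k * Q ^ (N - k)) n)"
    by (simp add: rot_coeff_def s_def c_def Q_def coeff_sum)
  also have "\<dots> = (\<Sum>k\<le>min n x. of_nat (x choose k) * (s / c) ^ (x - k) * coeff (monom ((- 1 / c) ^ k) k * Q ^ (N - k)) n)"
    by (intro sum.mono_neutral_right) (auto simp: coeff_monom_mult)
  also have "\<dots> = (\<Sum>k\<le>min n x. real (N choose n) * c ^ N * (s / c) ^ (n + x) * (pochhammer (- real n) k * pochhammer (- real x) k
       / (fact k * pochhammer (- real N) k) * (1 / s\<^sup>2) ^ k))"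
  proof (rule sum.cong)
    fix k assume "k \<in> {..min n x}"
    then have k: "k \<le> n" "k \<le> x" by auto
    have pw: "(s / c) ^ (x - k) * (- 1 / c) ^ k * (s ^ (n - k) * c ^ (N - k - (n - k)))
        = (- 1) ^ k * (c ^ N * (s / c) ^ (n + x) * (1 / s\<^sup>2) ^ k)"
    proof -
      obtain x' n' N' where x': "x = k + x'" "n = k + n'" "N = k + n' + N'"
        using k assms by (metis le_Suc_ex)
      show ?thesis using nz unfolding x' power_divide
        by (simp add: field_simps power_add power2_eq_square power_mult_distrib)
    qed
    have "of_nat (x choose k) * (s / c) ^ (x - k) * coeff (monom ((- 1 / c) ^ k) k * Q ^ (N - k)) n
       = real (x choose k) * real ((N - k) choose (n - k)) * ((s / c) ^ (x - k) * (- 1 / c) ^ k * (s ^ (n - k) * c ^ (N - k - (n - k))))"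
      using k assms by (simp add: coeff_monom_mult coeffQ)
    also have "\<dots> = ((- 1) ^ k * real (x choose k)) * real ((N - k) choose (n - k)) * (c ^ N * (s / c) ^ (n + x) * (1 / s\<^sup>2) ^ k)"
      unfolding pw by (simp only: mult_ac)
    also have "\<dots> = real (N choose n) * c ^ N * (s / c) ^ (n + x) * (pochhammer (- real n) k * pochhammer (- real x) k
       / (fact k * pochhammer (- real N) k) * (1 / s\<^sup>2) ^ k)"
      unfolding binomial_pochhammer_shift[OF k(1) assms(2)] pochhammer_minus_nat[OF k(2), symmetric]
      by (simp only: times_divide_eq_left times_divide_eq_right divide_divide_eq_left mult_ac)
    finally show "of_nat (x choose k) * (s / c) ^ (x - k) * coeff (monom ((- 1 / c) ^ k) k * Q ^ (N - k)) n
      = real (N choose n) * c ^ N * (s / c) ^ (n + x) * (pochhammer (- real n) k * pochhammer (- real x) k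
       / (fact k * pochhammer (- real N) k) * (1 / s\<^sup>2) ^ k)" .
  qed simp
  finally show ?thesis
    by (simp add: s_def c_def tan_def sum_distrib_left mult.assoc)
qed

context gt_index
begin

text \<open>
  On a string with fixed \<open>a\<close> and \<open>b\<close>, put \<open>N = b - 1 - a\<close> and \<open>j = c - a\<close>; then \<open>\<xi>\<close> corresponds to
  \<open>N! / (N - j)!\<close> times the binary form \<open>u^(N - j) v^j\<close>, with \<open>e21 = v d/du\<close> and \<open>e12 = u d/dv\<close>.
\<close>

definition zrot :: "real \<Rightarrow> imat" where
  "zrot t = restr (\<lambda>(a', b', c') (a, b, c). if a' = a \<and> b' = b
     then (- 1) ^ nat (b - 1 - c') * (ifac (c - a) / ifac (c' - a))
       * rot_coeff (nat (b - 1 - a)) (nat (b - 1 - c)) (nat (b - 1 - c')) t else 0)"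

lemma supported_zrot [simp]: "supported (zrot t)"
  by (simp add: zrot_def)

lemma zrot_0: "zrot 0 = diag (\<lambda>_. 1)"
proof (rule ext_pats)
  fix i j assume ij: "i \<in> pats" "j \<in> pats"
  obtain a b c where j: "j = (a, b, c)" by (cases j) auto
  obtain a' b' c' where i: "i = (a', b', c')" by (cases i) auto
  show "zrot 0 i j = diag (\<lambda>_. 1) i j"
    using ij unfolding i j by (auto simp: zrot_def diag_def restr_def rot_coeff_0 simp flip: power_add)
qed simp_all

lemma zrot_deriv: "((\<lambda>t. zrot t i j) has_real_derivative ((e21m - e12m) \<star> zrot t) i j) (at t)"
proof (cases "i \<in> pats \<and> j \<in> pats")
  case False
  then have "zrot t i j = 0" for t by (intro supportedD) auto
  moreover have "((e21m - e12m) \<star> zrot t) i j = 0"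
    using False by (intro mm_outside) auto
  ultimately show ?thesis by simp
next
  case True
  obtain a b c where j: "j = (a, b, c)" by (cases j) auto
  obtain a' b' c' where i: "i = (a', b', c')" by (cases i) auto
  have D: "((e21m - e12m) \<star> zrot t) i j = zrot t (a', b', c' - 1) j - of_int ((c' + 1 - a') * (b' - c' - 1)) * zrot t (a', b', c' + 1) j"
    using True unfolding i by (simp add: mm_diff_left e21_mm e12_mm del: mem_pats)
  show ?thesis
  proof (cases "a' = a \<and> b' = b")
    case False
    then have "zrot t (a', b', k) j = 0" for t k
      by (auto simp: zrot_def restr_def j)
    then show ?thesis unfolding D by (simp add: i)
  next
    case ab: True
    define N n x where "N = nat (b - 1 - a)" and "n = nat (b - 1 - c)" and "x = nat (b - 1 - c')"
    define K where "K = (- 1) ^ x * (ifac (c - a) / ifac (c' - a))"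
    have z: "zrot t i j = K * rot_coeff N n x t" for t
      using True ab unfolding i j by (simp add: zrot_def restr_def K_def N_def n_def x_def)
    \<comment> \<open>At the wall c' = a the neighbour is not a pattern, and N - x = 0 gives the
      same value.\<close>
    have 1: "zrot t (a', b', c' - 1) j = - K * (real (N - x) * rot_coeff N n (Suc x) t)"
    proof (cases "c' = a")
      case True
      then show ?thesis using ab \<open>i \<in> pats \<and> j \<in> pats\<close>
        unfolding i j by (simp add: zrot_def restr_def N_def x_def)
    next
      case False
      have "zrot t (a', b', c' - 1) j = (- 1) ^ nat (b - 1 - (c' - 1)) * (ifac (c - a) / ifac (c' - 1 - a))
          * rot_coeff N n (nat (b - 1 - (c' - 1))) t"
        using True ab False unfolding i j by (simp add: zrot_def restr_def N_def n_def)
      moreover have "nat (b - 1 - (c' - 1)) = Suc x"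
        using True ab False unfolding i j x_def by auto
      moreover have "ifac (c' - a) = real (N - x) * ifac (c' - 1 - a)"
      proof -
        have "real (N - x) = of_int (c' - a)"
          using True ab False unfolding i j x_def N_def by (auto simp: of_nat_nat)
        moreover have "ifac (c' - a) = of_int (c' - a) * ifac (c' - a - 1)"
          using True ab False unfolding i j by (intro ifac_rec) auto
        ultimately show ?thesis by (simp add: diff_diff_eq add.commute)
      qed
      moreover have "real (N - x) \<noteq> 0"
        using True ab False unfolding i j x_def N_def by auto
      ultimately show ?thesis by (simp add: K_def)
    qed
    have 2: "of_int ((c' + 1 - a') * (b' - c' - 1)) * zrot t (a', b', c' + 1) j = - K * (real x * rot_coeff N n (x - 1) t)"
    proof (cases "c' = b - 1")
      case True
      then show ?thesis using ab \<open>i \<in> pats \<and> j \<in> pats\<close>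
        unfolding i j by (simp add: x_def)
    next
      case False
      have "zrot t (a', b', c' + 1) j = (- 1) ^ nat (b - 1 - (c' + 1)) * (ifac (c - a) / ifac (c' + 1 - a))
          * rot_coeff N n (nat (b - 1 - (c' + 1))) t"
        using True ab False unfolding i j by (simp add: zrot_def restr_def N_def n_def)
      moreover have "nat (b - 1 - (c' + 1)) = x - 1" "x = Suc (x - 1)"
        using True ab False unfolding i j x_def by auto
      moreover have "ifac (c' + 1 - a) = of_int (c' + 1 - a) * ifac (c' - a)"
        using ifac_rec[of "c' + 1 - a"] True ab False unfolding i j by (simp add: algebra_simps)
      moreover have "real x = of_int (b' - c' - 1)"
        using True ab False unfolding i j x_def by auto
      moreover have "real_of_int (c' + 1 - a) \<noteq> 0"
        using True ab False unfolding i j x_def N_def by auto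
      moreover have "K = - ((- 1) ^ (x - 1)) * (ifac (c - a) / ifac (c' - a))"
        unfolding K_def using \<open>x = Suc (x - 1)\<close> by (metis mult_minus1 power_Suc)
      ultimately show ?thesis using ab by (simp del: of_int_add of_int_diff)
    qed
    have "x \<le> N" using True ab unfolding i j x_def N_def by auto
    from DERIV_cmult[OF rot_coeff_deriv[OF this, where n = n and t = t], of K]
    show ?thesis unfolding z D 1 2 by (simp add: algebra_simps)
  qed
qed

text \<open>Conjugation by W sends e12 - e21 to e13 - e31, whereas the generators of the z and y
  rotations are e12 - e21 and e31 - e13. This is the origin of the minus sign in the angle.\<close>

definition yrot :: "real \<Rightarrow> imat" where
  "yrot t = weyl \<star> zrot (- t) \<star> weyl"

lemma supported_yrot [simp]: "supported (yrot t)"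
  by (simp add: yrot_def)

lemma yrot_0: "yrot 0 = diag (\<lambda>_. 1)"
  by (simp add: yrot_def zrot_0 mm_diag_1 weyl_weyl)

lemma yrot_deriv: "((\<lambda>t. yrot t i j) has_real_derivative ((e13m - e31m) \<star> yrot t) i j) (at t)"
proof -
  have "((\<lambda>t. zrot (- t) k l) has_real_derivative - ((e21m - e12m) \<star> zrot (- t)) k l) (at t)" for k l
    using DERIV_chain2[where f = "\<lambda>t. zrot t k l" and g = uminus and x = t, OF zrot_deriv, of "- 1" UNIV]
      DERIV_minus[OF DERIV_ident, of t UNIV] by simp
  then have "((\<lambda>t. yrot t i j) has_real_derivative
      (\<Sum>l\<in>pats. (\<Sum>k\<in>pats. weyl i k * - ((e21m - e12m) \<star> zrot (- t)) k l) * weyl l j)) (at t)"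
    unfolding yrot_def mm_def[of _ weyl] mm_def[of weyl]
    by (intro DERIV_sum DERIV_cmult_right DERIV_cmult)
  also have "(\<Sum>l\<in>pats. (\<Sum>k\<in>pats. weyl i k * - ((e21m - e12m) \<star> zrot (- t)) k l) * weyl l j)
     = (weyl \<star> ((e12m - e21m) \<star> zrot (- t)) \<star> weyl) i j"
    unfolding mm_def[of _ weyl] mm_def[of weyl] mm_diff_left by (simp add: algebra_simps)
  also have "weyl \<star> ((e12m - e21m) \<star> zrot (- t)) \<star> weyl = (weyl \<star> (e12m - e21m)) \<star> zrot (- t) \<star> weyl"
    by (simp add: mm_assoc)
  also have "\<dots> = (e13m - e31m) \<star> yrot t"
    by (simp only: mm_diff_right weyl_e12 weyl_e21 yrot_def mm_diff_left mm_assoc)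
  finally show ?thesis .
qed

end

section \<open>The group representation\<close>

lemma matrix_inv_eqI:
  fixes A B :: "'a :: field ^ 'n ^ 'n"
  assumes "A ** B = mat 1" "B ** A = mat 1"
  shows "matrix_inv A = B"
proof -
  have "A ** matrix_inv A = mat 1 \<and> matrix_inv A ** A = mat 1"
    unfolding matrix_inv_def by (rule someI_ex) (use assms in blast)
  then have "matrix_inv A ** (A ** B) = B" by (simp add: matrix_mul_assoc)
  then show ?thesis using assms(1) by simp
qed

section \<open>Rotations as one-parameter subgroups of SL3\<close>

lemma complex_matrix_mult: "complex_matrix (A ** B) = complex_matrix A ** complex_matrix B"
  by (simp add: complex_matrix_def matrix_matrix_mult_def vec_eq_iff)

lemma Rz_add: "Rz (s + t) = Rz s ** Rz t"
  by (simp add: Rz_def vec_eq_iff forall_3 matrix_matrix_mult_def sum_3 cos_add sin_add)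

lemma Ry_add: "Ry (s + t) = Ry s ** Ry t"
  by (simp add: Ry_def vec_eq_iff forall_3 matrix_matrix_mult_def sum_3 cos_add sin_add)

lemma Rz_0: "Rz 0 = mat 1"
  by (simp add: Rz_def vec_eq_iff forall_3 mat_def)

lemma Ry_0: "Ry 0 = mat 1"
  by (simp add: Ry_def vec_eq_iff forall_3 mat_def)

lemma complex_matrix_1: "complex_matrix (mat 1) = mat 1"
  by (simp add: complex_matrix_def mat_def vec_eq_iff)

lemma complex_sin_cos_squared: "complex_of_real (cos t) * complex_of_real (cos t) + complex_of_real (sin t) * complex_of_real (sin t) = 1"
  by (metis of_real_1 of_real_add of_real_mult power2_eq_square sin_cos_squared_add2)

lemma Rz_SL3: "complex_matrix (Rz t) \<in> SL3"
  by (simp add: SL3_def det_3 complex_matrix_def Rz_def complex_sin_cos_squared)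

lemma Ry_SL3: "complex_matrix (Ry t) \<in> SL3"
  by (simp add: SL3_def det_3 complex_matrix_def Ry_def complex_sin_cos_squared)

lemma SL3_mult: "g \<in> SL3 \<Longrightarrow> h \<in> SL3 \<Longrightarrow> g ** h \<in> SL3"
  by (simp add: SL3_def det_mul)

definition gen_z :: "complex^3^3" where
  "gen_z = vector [vector [0, 1, 0], vector [- 1, 0, 0], vector [0, 0, 0]]"

definition gen_y :: "complex^3^3" where
  "gen_y = vector [vector [0, 0, - 1], vector [0, 0, 0], vector [1, 0, 0]]"

lemma one_parameter_Rz: "one_parameter_subgroup gen_z (\<lambda>t. complex_matrix (Rz t))"
  unfolding one_parameter_subgroup_def
proof (intro conjI allI)
  have "complex_matrix (Rz t) = cos t *\<^sub>R vector [vector [1, 0, 0], vector [0, 1, 0], vector [0, 0, 0]]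
     + sin t *\<^sub>R gen_z + vector [vector [0, 0, 0], vector [0, 0, 0], vector [0, 0, 1]]" for t
    by (simp add: complex_matrix_def Rz_def gen_z_def vec_eq_iff forall_3 scaleR_conv_of_real[where 'a = complex])
  then show "((\<lambda>t. complex_matrix (Rz t)) has_vector_derivative gen_z) (at 0)"
    by (auto intro!: derivative_eq_intros)
qed (simp_all add: Rz_SL3 Rz_add complex_matrix_mult)

lemma one_parameter_Ry: "one_parameter_subgroup gen_y (\<lambda>t. complex_matrix (Ry t))"
  unfolding one_parameter_subgroup_def
proof (intro conjI allI)
  have "complex_matrix (Ry t) = cos t *\<^sub>R vector [vector [1, 0, 0], vector [0, 0, 0], vector [0, 0, 1]]
     + sin t *\<^sub>R gen_y + vector [vector [0, 0, 0], vector [0, 1, 0], vector [0, 0, 0]]" for t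
    by (simp add: complex_matrix_def Ry_def gen_y_def vec_eq_iff forall_3 scaleR_conv_of_real[where 'a = complex])
  then show "((\<lambda>t. complex_matrix (Ry t)) has_vector_derivative gen_y) (at 0)"
    by (auto intro!: derivative_eq_intros)
qed (simp_all add: Ry_SL3 Ry_add complex_matrix_mult)

lemma gen_sl3: "gen_z \<in> sl3" "gen_y \<in> sl3"
  by (simp_all add: sl3_def trace_def sum_3 gen_z_def gen_y_def)

context gt_index
begin

section \<open>The root vectors e23 and e32 and their commutators\<close>

definition e23m :: imat where
  "e23m = restr (\<lambda>i (a, b, c).
     if i = (a - 1, b, c) then of_int a / of_int (b - a)
     else if i = (a, b - 1, c) then of_int b / of_int (b - a) else 0)"

definition e32m :: imat where
  "e32m = restr (\<lambda>i (a, b, c).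
     if i = (a + 1, b, c) then of_int ((p - a) * (P - a) * (c - a)) / of_int (b - a)
     else if i = (a, b + 1, c) then of_int ((b - c) * (b - p) * (P - b)) / of_int (b - a) else 0)"

lemma supported_e' [simp]: "supported e23m" "supported e32m"
  by (simp_all add: e23m_def e32m_def)

lemma mm_e23:
  assumes A: "supported A" and "(a, b, c) \<in> pats"
  shows "(A \<star> e23m) i (a, b, c) =
     of_int a / of_int (b - a) * A i (a - 1, b, c) + of_int b / of_int (b - a) * A i (a, b - 1, c)"
  using supportedD[OF A, of i "(a - 1, b, c)"] supportedD[OF A, of i "(a, b - 1, c)"] assms(2)
  unfolding mm_def
  by (subst sum_two[where x = "(a - 1, b, c)" and y = "(a, b - 1, c)"])
     (auto simp: e23m_def restr_def mult.commute simp del: of_int_mult of_int_diff)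

lemma mm_e32:
  assumes A: "supported A" and "(a, b, c) \<in> pats"
  shows "(A \<star> e32m) i (a, b, c) =
     of_int ((p - a) * (P - a) * (c - a)) / of_int (b - a) * A i (a + 1, b, c)
     + of_int ((b - c) * (b - p) * (P - b)) / of_int (b - a) * A i (a, b + 1, c)"
  using supportedD[OF A, of i "(a + 1, b, c)"] supportedD[OF A, of i "(a, b + 1, c)"] assms(2)
  unfolding mm_def
  by (subst sum_two[where x = "(a + 1, b, c)" and y = "(a, b + 1, c)"])
     (auto simp: e32m_def restr_def mult.commute simp del: of_int_mult of_int_diff)

lemma e12m_eq_0: "i \<noteq> (a, b, c - 1) \<Longrightarrow> e12m i (a, b, c) = 0"
  by (simp add: e12m_def restr_def)

lemma e21m_eq_0: "i \<noteq> (a, b, c + 1) \<Longrightarrow> e21m i (a, b, c) = 0"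
  by (simp add: e21m_def restr_def)

lemma e23m_eq_0: "i \<noteq> (a - 1, b, c) \<Longrightarrow> i \<noteq> (a, b - 1, c) \<Longrightarrow> e23m i (a, b, c) = 0"
  by (simp add: e23m_def restr_def)

lemma e32m_eq_0: "i \<noteq> (a + 1, b, c) \<Longrightarrow> i \<noteq> (a, b + 1, c) \<Longrightarrow> e32m i (a, b, c) = 0"
  by (simp add: e32m_def restr_def)

text \<open>The coefficients of \<open>e23m\<close> do not involve c, so only differences of
  \<open>e12m\<close> coefficients survive: (c - a + 1)(b - c) - (c - a)(b - c) = b - c, and (c -
  a)(b - c - 1) - (c - a)(b - c) = -(c - a).\<close>

lemma e13m_commutator: "e12m \<star> e23m - e23m \<star> e12m = e13m"
proof (rule ext_pats)
  fix i j assume ij: "i \<in> pats" "j \<in> pats"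
  obtain a b c where j: "j = (a, b, c)" by (cases j) auto
  define d where "d = real_of_int (b - a)"
  have d: "d \<noteq> 0" using ij by (simp add: j d_def)
  have eq: "(e12m \<star> e23m - e23m \<star> e12m) i j
      = of_int a / d * e12m i (a - 1, b, c) + of_int b / d * e12m i (a, b - 1, c)
        - of_int ((c - a) * (b - c)) * e23m i (a, b, c - 1)"
    using ij unfolding j d_def by (simp add: mm_e23 mm_e12 del: mem_pats of_int_diff of_int_mult)
  consider "i = (a - 1, b, c - 1)" | "i = (a, b - 1, c - 1)"
    | "i \<noteq> (a - 1, b, c - 1)" "i \<noteq> (a, b - 1, c - 1)" by blast
  then show "(e12m \<star> e23m - e23m \<star> e12m) i j = e13m i j"
  proof cases
    case 1
    have "e12m i (a - 1, b, c) = of_int ((c - a + 1) * (b - c))" "e12m i (a, b - 1, c) = 0"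
      "of_int ((c - a) * (b - c)) * e23m i (a, b, c - 1) = of_int ((c - a) * (b - c)) * (of_int a / d)"
      "e13m i j = of_int (a * (b - c)) / d"
      using ij unfolding j 1 d_def by (auto simp: e12m_def e23m_def e13m_def restr_def)
    note v = this
    show ?thesis unfolding eq v using d by (simp add: field_simps)
  next
    case 2
    have "e12m i (a - 1, b, c) = 0" "e12m i (a, b - 1, c) = of_int ((c - a) * (b - c - 1))"
      "of_int ((c - a) * (b - c)) * e23m i (a, b, c - 1) = of_int ((c - a) * (b - c)) * (of_int b / d)"
      "e13m i j = - (of_int (b * (c - a)) / d)"
      using ij unfolding j 2 d_def by (auto simp: e12m_def e23m_def e13m_def restr_def)
    note v = this
    show ?thesis unfolding eq v using d by (simp add: field_simps)
  next
    case 3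
    then show ?thesis
      unfolding eq unfolding j by (simp add: e13m_eq_0 e12m_eq_0 e23m_eq_0)
  qed
qed simp_all

text \<open>The coefficients of \<open>e32m\<close> are linear in c through c - a and b - c; their
  differences in c are 1 and -1, which produces the signs in \<open>e31m\<close>.\<close>

lemma e31m_commutator: "e32m \<star> e21m - e21m \<star> e32m = e31m"
proof (rule ext_pats)
  fix i j assume ij: "i \<in> pats" "j \<in> pats"
  obtain a b c where j: "j = (a, b, c)" by (cases j) auto
  define d where "d = real_of_int (b - a)"
  have d: "d \<noteq> 0" using ij by (simp add: j d_def)
  have eq: "(e32m \<star> e21m - e21m \<star> e32m) i j = e32m i (a, b, c + 1)
        - (of_int ((p - a) * (P - a) * (c - a)) / d * e21m i (a + 1, b, c)
        + of_int ((b - c) * (b - p) * (P - b)) / d * e21m i (a, b + 1, c))"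
    using ij unfolding j d_def by (simp add: mm_e32 mm_e21 del: mem_pats of_int_diff of_int_mult)
  consider "i = (a + 1, b, c + 1)" | "i = (a, b + 1, c + 1)"
    | "i \<noteq> (a + 1, b, c + 1)" "i \<noteq> (a, b + 1, c + 1)" by blast
  then show "(e32m \<star> e21m - e21m \<star> e32m) i j = e31m i j"
  proof cases
    case 1
    have "e32m i (a, b, c + 1) = of_int ((p - a) * (P - a) * (c + 1 - a)) / d"
      "of_int ((p - a) * (P - a) * (c - a)) / d * e21m i (a + 1, b, c) = of_int ((p - a) * (P - a) * (c - a)) / d"
      "e21m i (a, b + 1, c) = 0"
      "e31m i j = of_int ((p - a) * (P - a)) / d"
      using ij unfolding j 1 d_def by (auto simp: e21m_def e32m_def e31m_def restr_def)
    note v = this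
    show ?thesis unfolding eq v using d by (simp add: field_simps)
  next
    case 2
    have "e32m i (a, b, c + 1) = of_int ((b - c - 1) * (b - p) * (P - b)) / d"
      "e21m i (a + 1, b, c) = 0" "e21m i (a, b + 1, c) = 1"
      "e31m i j = - (of_int ((b - p) * (P - b)) / d)"
      using ij unfolding j 2 d_def by (auto simp: e21m_def e32m_def e31m_def restr_def)
    note v = this
    show ?thesis unfolding eq v using d by (simp add: field_simps)
  next
    case 3
    then show ?thesis
      unfolding eq unfolding j by (simp add: e31m_eq_0 e21m_eq_0 e32m_eq_0)
  qed
qed simp_all

end

section \<open>The module in integer coordinates\<close>

lemma of_int_in_Nats: "real_of_int k \<in> \<nat> \<longleftrightarrow> 0 \<le> k"
proof
  assume "real_of_int k \<in> \<nat>"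
  then show "0 \<le> k" by (auto elim!: Nats_cases)
next
  assume "0 \<le> k"
  then show "real_of_int k \<in> \<nat>" by (metis of_int_of_nat_eq of_nat_in_Nats nat_0_le)
qed

text \<open>\<open>r\<close> is the first entry of the highest weight, a multiple of 1/3 that fixes
  the coset of all pattern entries; the assumption is the vanishing of the weight sum.\<close>

locale gt_module = gt_index +
  fixes r :: real
  assumes r: "3 * r = of_int (p + P - 1)"
begin

definition lam :: triple where
  "lam = (r, r - of_int p, r + 1 - of_int P)"

definition pat :: "idx \<Rightarrow> triple" where
  "pat = (\<lambda>(a, b, c). (r - of_int c, r - of_int a, r + 1 - of_int b))"

lemma pat_eq_iff [simp]: "pat i = pat j \<longleftrightarrow> i = j"
  by (cases i; cases j) (auto simp: pat_def)

lemma pat_in_iff: "pat i \<in> gt_patterns lam \<longleftrightarrow> i \<in> pats"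
proof -
  obtain a b c where i: "i = (a, b, c)" by (cases i) auto
  have e: "r - (r - real_of_int a) = of_int a" "r - real_of_int a - (r - of_int p) = of_int (p - a)"
    "r - real_of_int p - (r + 1 - of_int b) = of_int (b - p - 1)"
    "r + 1 - real_of_int b - (r + 1 - of_int P) = of_int (P - b)"
    "r - real_of_int a - (r - of_int c) = of_int (c - a)"
    "r - real_of_int c - (r + 1 - of_int b) = of_int (b - c - 1)" by simp_all
  show ?thesis
    unfolding lam_def pat_def i gt_patterns.simps prod.case mem_Collect_eq e of_int_in_Nats by auto
qed

lemma pat_image: "gt_patterns lam = pat ` pats"
proof
  show "pat ` pats \<subseteq> gt_patterns lam" using pat_in_iff by auto
  show "gt_patterns lam \<subseteq> pat ` pats"
  proof
    fix L assume L: "L \<in> gt_patterns lam"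
    obtain x y z where Lxyz: "L = (x, y, z)" by (cases L) auto
    have "r - y \<in> \<int>" "y - x \<in> \<int>" "x - z \<in> \<int>"
      using L by (auto simp: Lxyz lam_def Nats_altdef1)
    then obtain a b c where "r - y = of_int a" "y - x = of_int b" "x - z = of_int c"
      by (auto elim!: Ints_cases)
    \<comment> \<open>Here a, b, c are the successive differences of the chain from \<open>r\<close>
      down to z; their partial sums give the codes, the middle one shifted by 1.\<close>
    then have "L = pat (a, a + b + c + 1, a + b)" by (auto simp: pat_def Lxyz)
    then show "L \<in> pat ` pats" using L pat_in_iff by auto
  qed
qed

lemma finite_gt_patterns: "finite (gt_patterns lam)"
  by (simp add: pat_image)

lemma sum_gt_patterns: "(\<Sum>L\<in>gt_patterns lam. f L) = (\<Sum>j\<in>pats. f (pat j))"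
  unfolding pat_image by (subst sum.reindex) (auto simp: inj_on_def)

lemma xi_pat: "\<xi> lam (pat i) (pat j) = (if i \<in> pats \<and> j = i then 1 else 0)"
  by (auto simp: \<xi>_def pat_in_iff)

definition act :: "imat \<Rightarrow> (idx \<Rightarrow> complex) \<Rightarrow> idx \<Rightarrow> complex" where
  "act A v i = (\<Sum>j\<in>pats. of_real (A i j) * v j)"

lemma act_mm: "act (A \<star> B) v i = act A (act B v) i"
  unfolding act_def mm_def of_real_sum sum_distrib_left sum_distrib_right
  by (subst sum.swap) (simp add: mult.assoc)

lemma act_diff: "act (A - B) v i = act A v i - act B v i"
  by (simp add: act_def left_diff_distrib sum_subtractf)

lemma act_cong: "(\<And>j. j \<in> pats \<Longrightarrow> v j = w j) \<Longrightarrow> act A v i = act A w i"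
  by (simp add: act_def)

lemma lin_ext_pat:
  assumes "i \<in> pats" "\<And>j. j \<in> pats \<Longrightarrow> f (pat j) (pat i) = of_real (A i j)"
  shows "lin_ext lam f v (pat i) = act A (v \<circ> pat) i"
  using assms by (simp add: lin_ext_def sum_gt_patterns act_def mult.commute)

lemma e12_pat: "i \<in> pats \<Longrightarrow> e12 lam v (pat i) = act e12m (v \<circ> pat) i"
  unfolding e12_def
proof (rule lin_ext_pat)
  fix j assume ij: "i \<in> pats" "j \<in> pats"
  obtain a b c where j: "j = (a, b, c)" by (cases j) auto
  have "(r - of_int c + 1, r - of_int a, r + 1 - of_int b) = pat (a, b, c - 1)" by (simp add: pat_def)
  then show "(case pat j of (l11, l21, l22) \<Rightarrow> \<lambda>M. complex_of_real ((l21 - l11) * (l11 - l22 + 1)) * \<xi> lam (l11 + 1, l21, l22) M) (pat i) = of_real (e12m i j)"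
    using ij unfolding j by (subst pat_def) (auto simp: xi_pat e12m_def restr_def)
qed

lemma e21_pat: "i \<in> pats \<Longrightarrow> e21 lam v (pat i) = act e21m (v \<circ> pat) i"
  unfolding e21_def
proof (rule lin_ext_pat)
  fix j assume ij: "i \<in> pats" "j \<in> pats"
  obtain a b c where j: "j = (a, b, c)" by (cases j) auto
  have "(r - of_int c - 1, r - of_int a, r + 1 - of_int b) = pat (a, b, c + 1)" by (simp add: pat_def)
  then show "(case pat j of (l11, l21, l22) \<Rightarrow> \<lambda>M. \<xi> lam (l11 - 1, l21, l22) M) (pat i) = of_real (e21m i j)"
    using ij unfolding j by (subst pat_def) (auto simp: xi_pat e21m_def restr_def)
qed

lemma e23_pat: "i \<in> pats \<Longrightarrow> e23 lam v (pat i) = act e23m (v \<circ> pat) i"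
  unfolding e23_def lam_def Let_def prod.case unfolding lam_def[symmetric]
proof (rule lin_ext_pat)
  fix j assume ij: "i \<in> pats" "j \<in> pats"
  obtain a b c where j: "j = (a, b, c)" by (cases j) auto
  have *: "(r - of_int c, r - of_int a + 1, r + 1 - of_int b) = pat (a - 1, b, c)"
    "(r - of_int c, r - of_int a, r + 1 - of_int b + 1) = pat (a, b - 1, c)" by (simp_all add: pat_def)
  have **: "r - (r - real_of_int a) = of_int a" "r - real_of_int a - (r + 1 - of_int b) + 1 = of_int (b - a)"
    "r - (r + 1 - of_int b) + 1 = real_of_int b" by simp_all
  show "(case pat j of (l11, l21, l22) \<Rightarrow> \<lambda>M. complex_of_real ((r - l21) / (l21 - l22 + 1)) * \<xi> lam (l11, l21 + 1, l22) M +
       complex_of_real ((r - l22 + 1) / (l21 - l22 + 1)) * \<xi> lam (l11, l21, l22 + 1) M) (pat i) = of_real (e23m i j)"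
    using ij unfolding j
    apply (subst pat_def)
    unfolding prod.case * ** xi_pat by (auto simp: e23m_def restr_def)
qed

lemma e32_pat: "i \<in> pats \<Longrightarrow> e32 lam v (pat i) = act e32m (v \<circ> pat) i"
  unfolding e32_def lam_def Let_def prod.case unfolding lam_def[symmetric]
proof (rule lin_ext_pat)
  fix j assume ij: "i \<in> pats" "j \<in> pats"
  obtain a b c where j: "j = (a, b, c)" by (cases j) auto
  have *: "(r - of_int c, r - of_int a - 1, r + 1 - of_int b) = pat (a + 1, b, c)"
    "(r - of_int c, r - of_int a, r + 1 - of_int b - 1) = pat (a, b + 1, c)" by (simp_all add: pat_def)
  have **: "r - real_of_int a - (r - of_int p) = of_int (p - a)"
    "r - real_of_int a - (r + 1 - of_int b) + 1 = of_int (b - a)"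
    "r - real_of_int a - (r + 1 - of_int P) + 1 = of_int (P - a)"
    "r - real_of_int a - (r - of_int c) = of_int (c - a)"
    "r - real_of_int c - (r + 1 - of_int b) + 1 = of_int (b - c)"
    "r - real_of_int p - (r + 1 - of_int b) + 1 = of_int (b - p)"
    "r + 1 - real_of_int b - (r + 1 - of_int P) = of_int (P - b)" by simp_all
  show "(case pat j of (l11, l21, l22) \<Rightarrow> \<lambda>M. complex_of_real ((l21 - (r - of_int p)) * (l21 - (r + 1 - of_int P) + 1) * (l21 - l11) / (l21 - l22 + 1)) * \<xi> lam (l11, l21 - 1, l22) M +
       complex_of_real ((l11 - l22 + 1) * (r - of_int p - l22 + 1) * (l22 - (r + 1 - of_int P)) / (l21 - l22 + 1)) * \<xi> lam (l11, l21, l22 - 1) M) (pat i) = of_real (e32m i j)"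
    using ij unfolding j
    apply (subst pat_def)
    unfolding prod.case * ** xi_pat by (auto simp: e32m_def restr_def)
qed

lemma e13_pat: "i \<in> pats \<Longrightarrow> e13 lam v (pat i) = act e13m (v \<circ> pat) i"
  unfolding e13m_commutator[symmetric] act_diff act_mm e13_def op_commutator_def
  by (simp add: e12_pat e23_pat cong: act_cong)

lemma e31_pat: "i \<in> pats \<Longrightarrow> e31 lam v (pat i) = act e31m (v \<circ> pat) i"
  unfolding e31m_commutator[symmetric] act_diff act_mm e31_def op_commutator_def
  by (simp add: e32_pat e21_pat cong: act_cong)

lemma sl3_action_gen_z: "i \<in> pats \<Longrightarrow> sl3_action lam gen_z v (pat i) = act (e12m - e21m) (v \<circ> pat) i"
  by (simp add: sl3_action_def gen_z_def e12_pat e21_pat act_diff)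

lemma sl3_action_gen_y: "i \<in> pats \<Longrightarrow> sl3_action lam gen_y v (pat i) = act (e31m - e13m) (v \<circ> pat) i"
  by (simp add: sl3_action_def gen_y_def e13_pat e31_pat act_diff)

lemma gt_space_expand:
  assumes "v \<in> gt_space lam"
  shows "v = (\<lambda>M. \<Sum>k\<in>pats. v (pat k) * \<xi> lam (pat k) M)"
proof
  fix M
  show "v M = (\<Sum>k\<in>pats. v (pat k) * \<xi> lam (pat k) M)"
  proof (cases "M \<in> gt_patterns lam")
    case True
    then obtain i where i: "M = pat i" "i \<in> pats" unfolding pat_image by auto
    have "(\<Sum>k\<in>pats. v (pat k) * \<xi> lam (pat k) M) = (\<Sum>k\<in>pats. if k = i then v (pat k) else 0)"
      unfolding i(1) xi_pat by (intro sum.cong) auto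
    then show ?thesis using i by simp
  next
    case False
    then have "v M = 0" using assms unfolding gt_space_def by blast
    moreover have "\<xi> lam (pat k) M = 0" if "k \<in> pats" for k
      using False that by (auto simp: \<xi>_def pat_image)
    ultimately show ?thesis by simp
  qed
qed

lemma xi_in_gt_space: "\<xi> lam L \<in> gt_space lam"
  by (auto simp: gt_space_def \<xi>_def)

lemma sum_in_gt_space: "(\<lambda>M. \<Sum>k\<in>A. c k * \<xi> lam (pat k) M) \<in> gt_space lam"
  by (auto simp: gt_space_def \<xi>_def intro!: sum.neutral)

context
  fixes rep :: "complex^3^3 \<Rightarrow> gt_vector \<Rightarrow> gt_vector"
  assumes rep: "integrates_sl3_action lam rep"
begin

section \<open>Matrix coefficients of the group representation\<close>

lemma rep_closed: "g \<in> SL3 \<Longrightarrow> v \<in> gt_space lam \<Longrightarrow> rep g v \<in> gt_space lam"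
  using rep by (simp add: integrates_sl3_action_def)

lemma rep_lincomb: "g \<in> SL3 \<Longrightarrow> v \<in> gt_space lam \<Longrightarrow> w \<in> gt_space lam \<Longrightarrow>
  rep g (\<lambda>M. a * v M + b * w M) = (\<lambda>M. a * rep g v M + b * rep g w M)"
  using rep by (simp add: integrates_sl3_action_def)

lemma rep_one: "v \<in> gt_space lam \<Longrightarrow> rep (mat 1) v = v"
  using rep by (simp add: integrates_sl3_action_def)

lemma rep_mult: "g \<in> SL3 \<Longrightarrow> h \<in> SL3 \<Longrightarrow> v \<in> gt_space lam \<Longrightarrow> rep (g ** h) v = rep g (rep h v)"
  using rep by (simp add: integrates_sl3_action_def)

lemma rep_deriv:
  "X \<in> sl3 \<Longrightarrow> one_parameter_subgroup X g \<Longrightarrow> v \<in> gt_space lam \<Longrightarrow>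
    ((\<lambda>t. rep (g t) v M) has_vector_derivative sl3_action lam X v M) (at 0)"
  using rep unfolding integrates_sl3_action_def by blast

lemma rep_sum:
  assumes "g \<in> SL3" "finite A"
  shows "rep g (\<lambda>M. \<Sum>k\<in>A. c k * \<xi> lam (pat k) M) = (\<lambda>M. \<Sum>k\<in>A. c k * rep g (\<xi> lam (pat k)) M)"
  using assms(2)
proof (induction A rule: finite_induct)
  case empty
  have "rep g (\<lambda>M. 0 * \<xi> lam (pat undefined) M + 0 * \<xi> lam (pat undefined) M) = (\<lambda>M. 0)"
    by (subst rep_lincomb) (simp_all add: assms(1) xi_in_gt_space)
  then show ?case by simp
next
  case (insert k A)
  have "rep g (\<lambda>M. c k * \<xi> lam (pat k) M + 1 * (\<Sum>k\<in>A. c k * \<xi> lam (pat k) M))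
      = (\<lambda>M. c k * rep g (\<xi> lam (pat k)) M + 1 * rep g (\<lambda>M. \<Sum>k\<in>A. c k * \<xi> lam (pat k) M) M)"
    by (rule rep_lincomb) (simp_all add: assms(1) xi_in_gt_space sum_in_gt_space)
  then show ?case using insert by simp
qed

definition rmat :: "complex^3^3 \<Rightarrow> idx \<Rightarrow> idx \<Rightarrow> complex" where
  "rmat g i j = rep g (\<xi> lam (pat j)) (pat i)"

lemma rep_pat:
  assumes "g \<in> SL3" "v \<in> gt_space lam"
  shows "rep g v (pat i) = (\<Sum>k\<in>pats. rmat g i k * v (pat k))"
  by (subst gt_space_expand[OF assms(2)]) (simp add: rep_sum assms(1) rmat_def mult.commute)

lemma rmat_mult:
  assumes "g \<in> SL3" "h \<in> SL3"
  shows "rmat (g ** h) i j = (\<Sum>k\<in>pats. rmat g i k * rmat h k j)"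
  using assms unfolding rmat_def
  by (simp add: rep_mult xi_in_gt_space rep_pat[of g "rep h _"] rep_closed rmat_def)

lemma rmat_one: "rmat (mat 1) i j = (if j \<in> pats \<and> i = j then 1 else 0)"
  by (simp add: rmat_def rep_one xi_in_gt_space xi_pat)

text \<open>
  The differential equations for \<open>rmat (g t)\<close> and \<open>F t\<close> make the derivative of their product vanish.
\<close>

lemma rmat_one_parameter:
  assumes X: "X \<in> sl3" and g: "one_parameter_subgroup X g" and g0: "g 0 = mat 1"
    and act: "\<And>v i. i \<in> pats \<Longrightarrow> sl3_action lam X v (pat i) = act A (v \<circ> pat) i"
    and F0: "F 0 = diag (\<lambda>_. 1)"
    and F: "\<And>t i j. ((\<lambda>t. F t i j) has_real_derivative - ((A \<star> F t) i j)) (at t)"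
    and ij: "i \<in> pats" "j \<in> pats"
  shows "rmat (g (- t)) i j = of_real (F t i j)"
proof -
  have SL: "g t \<in> SL3" and add: "g (s + t) = g s ** g t" for s t
    using g by (auto simp: one_parameter_subgroup_def)
  have G0: "((\<lambda>h. rmat (g h) m k) has_vector_derivative of_real (A m k)) (at 0)" if "m \<in> pats" "k \<in> pats" for m k
  proof -
    have "act A (\<xi> lam (pat k) \<circ> pat) m = of_real (A m k)"
      using that by (simp add: act_def xi_pat if_distrib[of "\<lambda>x. _ * x"] cong: if_cong)
    then show ?thesis
      using rep_deriv[OF X g xi_in_gt_space, of "pat k" "pat m"] act[OF that(1)] by (simp add: rmat_def)
  qed
  \<comment> \<open>The derivative is given at 0 only; the group law g h = g t ** g (h - t) carries
    it to every t.\<close>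
  have G: "((\<lambda>t. rmat (g t) i k) has_vector_derivative (\<Sum>m\<in>pats. rmat (g t) i m * of_real (A m k))) (at t)"
    if "k \<in> pats" for i k t
  proof -
    have "((\<lambda>h. \<Sum>m\<in>pats. rmat (g t) i m * rmat (g h) m k) has_vector_derivative
       (\<Sum>m\<in>pats. rmat (g t) i m * of_real (A m k))) (at (t - t))"
      using G0 that by (intro has_vector_derivative_sum has_vector_derivative_mult_right) auto
    moreover have "((\<lambda>h. h - t) has_vector_derivative 1) (at t)"
      by (auto intro!: derivative_eq_intros)
    ultimately have "((\<lambda>h. \<Sum>m\<in>pats. rmat (g t) i m * rmat (g (h - t)) m k) has_vector_derivative
       (\<Sum>m\<in>pats. rmat (g t) i m * of_real (A m k))) (at t)"
      using vector_diff_chain_at[of "\<lambda>h. h - t" 1 t] unfolding o_def by fastforce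
    moreover have "rmat (g h) i k = (\<Sum>m\<in>pats. rmat (g t) i m * rmat (g (h - t)) m k)" for h
      using rmat_mult[OF SL SL] add[of t "h - t"] by simp
    ultimately show ?thesis by simp
  qed
  define H where "H i t = (\<Sum>k\<in>pats. rmat (g t) i k * of_real (F t k j))" for i t
  have "(H i has_vector_derivative 0) (at t)" for i t
  proof -
    have "((\<lambda>t. of_real (F t k j) :: complex) has_vector_derivative of_real (- (A \<star> F t) k j)) (at t)" for k t
      by (rule has_vector_derivative_of_real) (use F[of k j t] in \<open>simp add: has_real_derivative_iff_has_vector_derivative\<close>)
    then have "(H i has_vector_derivative (\<Sum>k\<in>pats. rmat (g t) i k * of_real (- (A \<star> F t) k j)
        + (\<Sum>m\<in>pats. rmat (g t) i m * of_real (A m k)) * of_real (F t k j))) (at t)"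
      unfolding H_def[abs_def] using G
      by (intro has_vector_derivative_sum has_vector_derivative_mult) auto
    also have "(\<Sum>k\<in>pats. rmat (g t) i k * of_real (- (A \<star> F t) k j)
        + (\<Sum>m\<in>pats. rmat (g t) i m * of_real (A m k)) * of_real (F t k j)) = 0"
    proof -
      have "(\<Sum>k\<in>pats. (\<Sum>m\<in>pats. rmat (g t) i m * of_real (A m k)) * of_real (F t k j))
          = (\<Sum>m\<in>pats. rmat (g t) i m * of_real ((A \<star> F t) m j))"
        unfolding mm_def of_real_sum sum_distrib_left sum_distrib_right
        by (subst sum.swap) (simp add: mult.assoc)
      then show ?thesis by (simp add: sum.distrib sum_negf sum_subtractf)
    qed
    finally show ?thesis .
  qed
  then have H: "H i t = H i 0" for i t
    using has_vector_derivative_zero_constant[of UNIV "H i"] by (metis UNIV_I convex_UNIV)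
  have H0: "H i t = (if i = j then 1 else 0)" if "i \<in> pats" for i t
    unfolding H[of i t] using that ij(2)
    by (simp add: H_def g0 rmat_one F0 diag_def restr_def if_distrib[of "\<lambda>x. x * _"] cong: if_cong)
  have "rmat (g (- t)) i j = (\<Sum>k\<in>pats. rmat (g (- t)) i k * H k t)"
    using ij by (simp add: H0 if_distrib[of "\<lambda>x. _ * x"] cong: if_cong)
  also have "\<dots> = (\<Sum>m\<in>pats. (\<Sum>k\<in>pats. rmat (g (- t)) i k * rmat (g t) k m) * of_real (F t m j))"
    unfolding H_def sum_distrib_left sum_distrib_right by (subst sum.swap) (simp add: mult.assoc)
  also have "\<dots> = (\<Sum>m\<in>pats. rmat (mat 1) i m * of_real (F t m j))"
    using rmat_mult[OF SL SL, of "- t" t] add[of "- t" t] g0 by simp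
  also have "\<dots> = of_real (F t i j)"
    using ij by (simp add: rmat_one if_distrib[of "\<lambda>x. x * _"] cong: if_cong)
  finally show ?thesis .
qed

lemma rmat_Rz: "i \<in> pats \<Longrightarrow> j \<in> pats \<Longrightarrow> rmat (complex_matrix (Rz (- t))) i j = of_real (zrot t i j)"
  using zrot_deriv
  by (intro rmat_one_parameter[where X = gen_z and A = "e12m - e21m" and g = "\<lambda>t. complex_matrix (Rz t)"])
    (simp_all add: gen_sl3 one_parameter_Rz sl3_action_gen_z zrot_0 Rz_0 complex_matrix_1 mm_diff_left)

lemma rmat_Ry: "i \<in> pats \<Longrightarrow> j \<in> pats \<Longrightarrow> rmat (complex_matrix (Ry (- t))) i j = of_real (yrot t i j)"
  using yrot_deriv
  by (intro rmat_one_parameter[where X = gen_y and A = "e31m - e13m" and g = "\<lambda>t. complex_matrix (Ry t)"])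
    (simp_all add: gen_sl3 one_parameter_Ry sl3_action_gen_y yrot_0 Ry_0 complex_matrix_1 mm_diff_left)

text \<open>Inversion reverses the three rotations and negates their angles. \<open>zrot\<close> and
  \<open>yrot\<close> represent rotations by the negated angle, so the angles reappear unsigned,
  with \<open>phi\<close> on the left.\<close>

lemma rmat_rotation:
  assumes "i \<in> pats" "j \<in> pats"
  shows "rmat (matrix_inv (complex_matrix (Rz chi ** Ry theta ** Rz phi))) i j
    = of_real ((zrot phi \<star> yrot theta \<star> zrot chi) i j)"
proof -
  let ?inv = "complex_matrix (Rz (- phi)) ** complex_matrix (Ry (- theta)) ** complex_matrix (Rz (- chi))"
  have z: "Rz (- t) ** Rz t = mat 1" "Rz t ** Rz (- t) = mat 1" and y: "Ry (- t) ** Ry t = mat 1" "Ry t ** Ry (- t) = mat 1" for t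
    using Rz_add[of t "- t"] Rz_add[of "- t" t] Ry_add[of t "- t"] Ry_add[of "- t" t] by (simp_all add: Rz_0 Ry_0)
  have "Rz chi ** Ry theta ** Rz phi ** (Rz (- phi) ** Ry (- theta) ** Rz (- chi)) = mat 1"
    by (metis z y matrix_mul_assoc matrix_mul_rid)
  moreover have "Rz (- phi) ** Ry (- theta) ** Rz (- chi) ** (Rz chi ** Ry theta ** Rz phi) = mat 1"
    by (metis z y matrix_mul_assoc matrix_mul_rid)
  ultimately have "matrix_inv (complex_matrix (Rz chi ** Ry theta ** Rz phi)) = ?inv"
    by (intro matrix_inv_eqI) (simp_all add: complex_matrix_1 flip: complex_matrix_mult)
  moreover have "rmat ?inv i j = of_real ((zrot phi \<star> yrot theta \<star> zrot chi) i j)"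
    using assms by (simp add: rmat_mult Rz_SL3 Ry_SL3 SL3_mult rmat_Rz rmat_Ry mm_def of_real_sum)
  ultimately show ?thesis by simp
qed

end

end

section \<open>Collapsing the matrix product to the double sum\<close>

lemma min_nat_of_int: "nat \<lfloor>min (real_of_int n) (of_int x)\<rfloor> = min (nat n) (nat x)"
  by (simp add: min_def nat_mono)

lemma krawtchouk_of_int:
  assumes "0 \<le> n" "n \<le> N" "0 \<le> x" "x \<le> N"
  shows "krawtchouk (of_int n) (of_int x) q (of_int N)
    = (\<Sum>k\<le>min (nat n) (nat x). poch n k * poch x k / (fact k * poch N k) * (1 / q) ^ k)"
  using assms
  by (simp add: krawtchouk_def of_int_in_Nats hypergeo_sum_def min_nat_of_int mult_ac)

lemma rot_coeff_krawtchouk_of_int: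
  assumes "0 \<le> n" "n \<le> N" "0 \<le> x" "x \<le> N" "sin t \<noteq> 0" "cos t \<noteq> 0"
  shows "rot_coeff (nat N) (nat n) (nat x) t = ifac N / (ifac n * ifac (N - n)) * cos t ^ nat N * tan t ^ nat (n + x)
    * krawtchouk (of_int n) (of_int x) ((sin t)\<^sup>2) (of_int N)"
proof -
  have bin: "real (nat N choose nat n) = ifac N / (ifac n * ifac (N - n))"
    using assms binomial_fact[of "nat n" "nat N", where 'a = real]
    unfolding ifac_def nat_diff_distrib[OF assms(1,2)] by simp
  have e: "real (nat n) = of_int n" "real (nat x) = of_int x" "real (nat N) = of_int N"
    "nat n + nat x = nat (n + x)"
    using assms by (simp_all add: nat_add_distrib)
  have "nat x \<le> nat N" "nat n \<le> nat N" using assms by simp_all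
  from rot_coeff_krawtchouk[OF this assms(5,6)] show ?thesis
    unfolding krawtchouk_of_int[OF assms(1-4)] e bin .
qed

lemma ifact_of_int: "ifact (of_int k) = ifac k"
  by (simp add: ifact_def ifac_def)

lemma ipow_of_int: "0 \<le> k \<Longrightarrow> ipow x (of_int k) = x ^ nat k"
  by (simp add: ipow_def power_int_def)

lemma tan_minus_power: "tan (- t) ^ k = (- 1) ^ k * tan (t :: real) ^ k"
  using power_minus[of "tan t" k] by simp

lemma unit_steps_of_int: "unit_steps (of_int u + x) (of_int v + x) = (\<lambda>k. of_int k + x) ` {u..v}"
proof
  show "unit_steps (of_int u + x) (of_int v + x) \<subseteq> (\<lambda>k. of_int k + x) ` {u..v}"
  proof
    fix z assume z: "z \<in> unit_steps (of_int u + x) (of_int v + x)"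
    then obtain k where "z - (of_int u + x) = of_int k" by (auto simp: unit_steps_def elim!: Ints_cases)
    then have "z = of_int (u + k) + x" by simp
    then show "z \<in> (\<lambda>k. of_int k + x) ` {u..v}"
      using z by (intro image_eqI[of _ _ "u + k"]) (auto simp: unit_steps_def)
  qed
  show "(\<lambda>k. of_int k + x) ` {u..v} \<subseteq> unit_steps (of_int u + x) (of_int v + x)"
    by (auto simp: unit_steps_def algebra_simps simp flip: of_int_diff)
qed

text \<open>The offset \<open>x\<close> is the coset of the summation index: -r for n and r for
  l.\<close>

lemma sum_unit_steps_of_int:
  "(\<Sum>z\<in>unit_steps (of_int u + x) (of_int v + x). f z) = (\<Sum>k\<in>{u..v}. f (of_int k + x))"
  unfolding unit_steps_of_int by (subst sum.reindex) (auto simp: inj_on_def)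

context gt_index
begin

lemma zrot_entry:
  assumes "(a, b, c') \<in> pats" "(a, b, c) \<in> pats" "sin t \<noteq> 0" "cos t \<noteq> 0"
  shows "zrot t (a, b, c') (a, b, c) = (- 1) ^ nat (b - 1 - c')
    * (ifac (b - 1 - a) / (ifac (b - 1 - c) * ifac (c' - a)))
    * cos t ^ nat (b - 1 - a) * tan t ^ nat ((b - 1 - c) + (b - 1 - c'))
    * krawtchouk (of_int (b - 1 - c)) (of_int (b - 1 - c')) ((sin t)\<^sup>2) (of_int (b - 1 - a))"
proof -
  have "zrot t (a, b, c') (a, b, c) = (- 1) ^ nat (b - 1 - c') * (ifac (c - a) / ifac (c' - a))
       * rot_coeff (nat (b - 1 - a)) (nat (b - 1 - c)) (nat (b - 1 - c')) t"
    using assms by (simp add: zrot_def restr_def)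
  also have "rot_coeff (nat (b - 1 - a)) (nat (b - 1 - c)) (nat (b - 1 - c')) t
     = ifac (b - 1 - a) / (ifac (b - 1 - c) * ifac (b - 1 - a - (b - 1 - c)))
       * cos t ^ nat (b - 1 - a) * tan t ^ nat ((b - 1 - c) + (b - 1 - c'))
       * krawtchouk (of_int (b - 1 - c)) (of_int (b - 1 - c')) ((sin t)\<^sup>2) (of_int (b - 1 - a))"
    using assms by (intro rot_coeff_krawtchouk_of_int) auto
  also have "b - 1 - a - (b - 1 - c) = c - a" by simp
  finally show ?thesis by (simp add: mult_ac del: of_int_diff)
qed

text \<open>Only the tangent is odd in t. Its exponent replaces the sign in c' by the same sign in
  c.\<close>

lemma zrot_minus_entry:
  assumes "(a, b, c') \<in> pats" "(a, b, c) \<in> pats" "sin t \<noteq> 0" "cos t \<noteq> 0"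
  shows "zrot (- t) (a, b, c') (a, b, c) = (- 1) ^ nat (b - 1 - c)
    * (ifac (b - 1 - a) / (ifac (b - 1 - c) * ifac (c' - a)))
    * cos t ^ nat (b - 1 - a) * tan t ^ nat ((b - 1 - c) + (b - 1 - c'))
    * krawtchouk (of_int (b - 1 - c)) (of_int (b - 1 - c')) ((sin t)\<^sup>2) (of_int (b - 1 - a))"
proof -
  have "(- 1) ^ nat (b - 1 - c') * (- 1 :: real) ^ nat ((b - 1 - c) + (b - 1 - c')) = (- 1) ^ nat (b - 1 - c)"
  proof -
    have "nat ((b - 1 - c) + (b - 1 - c')) = nat (b - 1 - c) + nat (b - 1 - c')"
      using assms by (intro nat_add_distrib) auto
    then show ?thesis by (simp add: power_add)
  qed
  note sgn = this
  note z = zrot_entry[OF assms(1,2), of "- t", unfolded sin_minus cos_minus tan_minus_power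
      neg_equal_0_iff_equal power2_minus, OF assms(3,4)]
  show ?thesis unfolding z sgn[symmetric] by (simp only: mult_ac)
qed

text \<open>The parameter equations make the upper parameters -a', -b', -\<alpha>, -\<beta> and the
  lower ones -p, -P, -y. The two patterns guarantee that a' and \<alpha> are within the range where
  \<open>racah\<close> is a sum.\<close>

lemma racah_eq_racah_sum:
  assumes "(a', b', y) \<in> pats" "(\<alpha>, \<beta>, y) \<in> pats"
    and A: "A = - of_int p - 1" and B: "of_int a' + A + B + 1 = - real_of_int b'"
    and G: "G = - of_int y - 1" and D: "of_int \<alpha> + G + D + 1 = - real_of_int \<beta>"
    and BD: "B + D + 1 = - of_int P"
  shows "racah (of_int a') (of_int \<alpha>) A B G D * ifac y = racah_sum \<alpha> \<beta> a' b' y"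
proof -
  have N: "Min {- A - 1, - B - D - 1, - G - 1} = of_int (min p (min P y))"
  proof -
    have "- A - 1 = of_int p" "- B - D - 1 = of_int P" "- G - 1 = of_int y"
      using A BD G by simp_all
    then show ?thesis by (simp add: min_def)
  qed
  have "racah (of_int a') (of_int \<alpha>) A B G D =
     hypergeo_sum (nat \<lfloor>min (real_of_int a') (of_int \<alpha>)\<rfloor>)
             [- of_int a', of_int a' + A + B + 1, - of_int \<alpha>, of_int \<alpha> + G + D + 1] [A + 1, B + D + 1, G + 1] 1"
    unfolding racah_def Let_def N using assms(1,2) by (auto simp: of_int_in_Nats)
  also have "\<dots> = (\<Sum>k\<le>nat (min a' \<alpha>). poch a' k * poch b' k * poch \<alpha> k * poch \<beta> k
      / (poch p k * poch P k * poch y k * fact k))"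
  proof -
    have e: "A + 1 = - of_int p" "G + 1 = - of_int y" using A G by simp_all
    have "min (nat a') (nat \<alpha>) = nat (min a' \<alpha>)" by (simp add: min_def nat_mono)
    then show ?thesis unfolding hypergeo_sum_def B D BD e min_nat_of_int by simp
  qed
  finally have "racah (of_int a') (of_int \<alpha>) A B G D * ifac y
    = (\<Sum>k\<le>nat (min a' \<alpha>). poch a' k * poch b' k * poch \<alpha> k * poch \<beta> k
      / (poch p k * poch P k * poch y k * fact k) * ifac y)"
    by (simp add: sum_distrib_right)
  also have "\<dots> = (\<Sum>k\<le>nat (min a' \<alpha>). (- 1) ^ k * poch \<alpha> k * poch \<beta> k * poch a' k * poch b' k
     * ifac (y - int k) / (fact k * poch p k * poch P k))"
  proof (rule sum.cong)
    fix k assume "k \<in> {..nat (min a' \<alpha>)}"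
    then have "int k \<le> y" using assms(1,2) by auto
    then have e: "ifac y / poch y k = (- 1) ^ k * ifac (y - int k)"
      by (simp add: ifac_poch)
    have "poch a' k * poch b' k * poch \<alpha> k * poch \<beta> k / (poch p k * poch P k * poch y k * fact k) * ifac y
      = poch a' k * poch b' k * poch \<alpha> k * poch \<beta> k / (poch p k * poch P k * fact k) * (ifac y / poch y k)"
      by simp
    then show "poch a' k * poch b' k * poch \<alpha> k * poch \<beta> k / (poch p k * poch P k * poch y k * fact k) * ifac y
      = (- 1) ^ k * poch \<alpha> k * poch \<beta> k * poch a' k * poch b' k
     * ifac (y - int k) / (fact k * poch p k * poch P k)"
      unfolding e by (simp add: mult_ac)
  qed simp
  also have "\<dots> = racah_sum \<alpha> \<beta> a' b' y"
    using assms(1,2) by (subst racah_sum_upto[of "min a' \<alpha>"]) (auto simp: min_def)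
  finally show ?thesis .
qed

text \<open>
  The weight condition in \<open>weyl\<close> determines \<open>c\<close> from the other entries of the two patterns.
\<close>

definition third_index :: "int \<Rightarrow> int \<Rightarrow> int \<Rightarrow> int \<Rightarrow> int" where
  "third_index a b \<alpha> \<beta> = a + b + \<alpha> + \<beta> - p - P - 1"

text \<open>Rotations about z fix the first two codes and W fixes the third. A path through the five
  factors is therefore determined by the first two codes (\<alpha>, \<beta>) of the pattern between
  the two copies of W; the weight condition supplies both third codes.\<close>

lemma product_entry:
  assumes "(a', b', c') \<in> pats" "(a, b, c) \<in> pats"
  shows "(zrot t1 \<star> (weyl \<star> zrot t2 \<star> weyl) \<star> zrot t3) (a', b', c') (a, b, c)
    = (\<Sum>(\<alpha>, \<beta>)\<in>{0..p} \<times> {p + 1..P}.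
        zrot t1 (a', b', c') (a', b', third_index a' b' \<alpha> \<beta>) * weyl (a', b', third_index a' b' \<alpha> \<beta>) (\<alpha>, \<beta>, third_index a' b' \<alpha> \<beta>)
        * zrot t2 (\<alpha>, \<beta>, third_index a' b' \<alpha> \<beta>) (\<alpha>, \<beta>, third_index a b \<alpha> \<beta>)
        * (weyl (\<alpha>, \<beta>, third_index a b \<alpha> \<beta>) (a, b, third_index a b \<alpha> \<beta>) * zrot t3 (a, b, third_index a b \<alpha> \<beta>) (a, b, c)))"
proof -
  have zrot0: "zrot t (u, v, w) (u', v', w') = 0" if "u \<noteq> u' \<or> v \<noteq> v'" for t u v w u' v' w'
    using that by (auto simp: zrot_def restr_def)
  have weyl0: "weyl (u, v, w) (u', v', w') = 0" if "w \<noteq> w' \<or> w' \<noteq> third_index u v u' v'" for u v w u' v' w'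
    using that by (intro weyl_eq_0) (auto simp: third_index_def)
  have left: "(zrot t1 \<star> weyl) (a', b', c') (\<alpha>, \<beta>, k) = zrot t1 (a', b', c') (a', b', k) * weyl (a', b', k) (\<alpha>, \<beta>, k)" for \<alpha> \<beta> k
    unfolding mm_def
  proof (subst sum_one[where x = "(a', b', k)"])
    fix j assume "j \<noteq> (a', b', k)"
    then show "zrot t1 (a', b', c') j * weyl j (\<alpha>, \<beta>, k) = 0"
      using zrot0 weyl0 by (cases j) (metis mult_eq_0_iff)
  qed (use supportedD[OF supported_zrot, of _ "(a', b', k)"] in auto)
  have right: "(weyl \<star> zrot t3) (\<alpha>, \<beta>, k) (a, b, c) = weyl (\<alpha>, \<beta>, k) (a, b, k) * zrot t3 (a, b, k) (a, b, c)" for \<alpha> \<beta> k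
    unfolding mm_def
  proof (subst sum_one[where x = "(a, b, k)"])
    fix j assume "j \<noteq> (a, b, k)"
    then show "weyl (\<alpha>, \<beta>, k) j * zrot t3 j (a, b, c) = 0"
      using zrot0 weyl0 by (cases j) (metis mult_eq_0_iff)
  qed (use supportedD[OF supported_zrot, of "(a, b, k)"] in auto)
  have mid: "(zrot t2 \<star> (weyl \<star> zrot t3)) (\<alpha>, \<beta>, k) (a, b, c) = zrot t2 (\<alpha>, \<beta>, k) (\<alpha>, \<beta>, third_index a b \<alpha> \<beta>)
      * (weyl (\<alpha>, \<beta>, third_index a b \<alpha> \<beta>) (a, b, third_index a b \<alpha> \<beta>) * zrot t3 (a, b, third_index a b \<alpha> \<beta>) (a, b, c))" for \<alpha> \<beta> k
    unfolding mm_def[of "zrot t2"]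
  proof (subst sum_one[where x = "(\<alpha>, \<beta>, third_index a b \<alpha> \<beta>)"])
    fix j assume j: "j \<noteq> (\<alpha>, \<beta>, third_index a b \<alpha> \<beta>)"
    obtain u v w where uvw: "j = (u, v, w)" by (cases j) auto
    have "third_index u v a b = third_index a b u v" by (simp add: third_index_def)
    then show "zrot t2 (\<alpha>, \<beta>, k) j * (weyl \<star> zrot t3) j (a, b, c) = 0"
      using j zrot0[of \<alpha> u \<beta> v t2 k w] weyl0[of w w u v a b] unfolding uvw right by auto
  qed (use supportedD[OF supported_zrot, of _ "(\<alpha>, \<beta>, third_index a b \<alpha> \<beta>)"] in \<open>auto simp: right\<close>)
  define f where "f = (\<lambda>(\<alpha>, \<beta>, k). (zrot t1 \<star> weyl) (a', b', c') (\<alpha>, \<beta>, k) * (zrot t2 \<star> (weyl \<star> zrot t3)) (\<alpha>, \<beta>, k) (a, b, c))"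
  have f0: "f j = 0" if "j \<notin> pats" for j
    using that by (cases j) (simp add: f_def mm_outside del: mem_pats)
  have f1: "f (\<alpha>, \<beta>, k) = 0" if "k \<noteq> third_index a' b' \<alpha> \<beta>" for \<alpha> \<beta> k
    using that weyl0[of k k a' b' \<alpha> \<beta>] by (simp add: f_def left)
  have "(zrot t1 \<star> (weyl \<star> zrot t2 \<star> weyl) \<star> zrot t3) (a', b', c') (a, b, c)
      = ((zrot t1 \<star> weyl) \<star> (zrot t2 \<star> (weyl \<star> zrot t3))) (a', b', c') (a, b, c)"
    by (simp only: mm_assoc)
  also have "\<dots> = sum f pats"
    unfolding mm_def[of "zrot t1 \<star> weyl"] f_def by (intro sum.cong) auto
  also have "\<dots> = sum f (pats \<inter> {(\<alpha>, \<beta>, k). k = third_index a' b' \<alpha> \<beta>})"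
    using f1 by (intro sum.mono_neutral_right) auto
  also have "\<dots> = sum f ((\<lambda>(\<alpha>, \<beta>). (\<alpha>, \<beta>, third_index a' b' \<alpha> \<beta>)) ` ({0..p} \<times> {p + 1..P}))"
    using f0 by (intro sum.mono_neutral_left) (auto simp: image_iff)
  also have "\<dots> = (\<Sum>(\<alpha>, \<beta>)\<in>{0..p} \<times> {p + 1..P}. f (\<alpha>, \<beta>, third_index a' b' \<alpha> \<beta>))"
    by (subst sum.reindex) (auto simp: inj_on_def intro!: sum.cong)
  finally show ?thesis
    unfolding f_def prod.case left mid by (simp add: mult.assoc)
qed

end

context gt_module
begin

lemma t_coeff_lam:
  assumes "x = r - of_int a" "y = r - of_int c" "z = r + 1 - of_int b"
  shows "t_coeff lam x y z = weyl_scale (a, b, c) * ifac c"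
proof -
  have e: "x - z + 1 = of_int (b - a)" "r - (r - of_int p) = of_int p" "r - (r + 1 - of_int P) + 1 = of_int P"
    "r - y = of_int c" "r - of_int p - z = of_int (b - 1 - p)" "y - z = of_int (b - 1 - c)"
    "x - (r - of_int p) = of_int (p - a)" "x - (r + 1 - of_int P) + 1 = of_int (P - a)"
    "x - y = of_int (c - a)" "r - z + 1 = of_int b" "r - x = of_int a" "z - (r + 1 - of_int P) = of_int (P - b)"
    using assms by simp_all
  show ?thesis
    unfolding lam_def t_coeff.simps e ifact_of_int weyl_scale_def prod.case by (simp add: mult_ac)
qed

text \<open>The indices of the double sum encode the middle pattern: l and n - l are its entries
  with codes \<alpha> and \<beta>, since r + 1 - \<beta> = n - l by the trace condition.\<close>

lemma summand_eq:
  fixes a b c a' b' c' \<alpha> \<beta> :: int and n l l11 l21 l22 l11' l21' l22' chi theta phi l31 l32 l33 :: real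
  defines "y \<equiv> third_index a b \<alpha> \<beta>" and "y' \<equiv> third_index a' b' \<alpha> \<beta>"
  assumes pats: "(a, b, c) \<in> pats" "(a', b', c') \<in> pats" "(a, b, y) \<in> pats" "(a', b', y') \<in> pats"
      "(\<alpha>, \<beta>, y) \<in> pats" "(\<alpha>, \<beta>, y') \<in> pats"
    and L: "l31 = r" "l32 = r - of_int p" "l33 = r + 1 - of_int P"
      "l11 = r - of_int c" "l21 = r - of_int a" "l22 = r + 1 - of_int b"
      "l11' = r - of_int c'" "l21' = r - of_int a'" "l22' = r + 1 - of_int b'"
      "n = of_int (p + P - \<alpha> - \<beta>) - r" "l = r - of_int \<alpha>"
    and gen: "sin chi \<noteq> 0" "cos chi \<noteq> 0" "sin theta \<noteq> 0" "cos theta \<noteq> 0" "sin phi \<noteq> 0" "cos phi \<noteq> 0"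
  shows "\<mu> lam (l11', l21', l22') (l11, l21, l22) (chi, theta, phi) l n
        * krawtchouk (n + l21') (l11' - l22') ((sin phi)\<^sup>2) (l21' - l22')
        * racah (l31 - l21') (l31 - l) (l32 - l31 - 1) (l21' + l22' + l33 - 1)
            (n + l21' + l22' - l31 - 1) (- l21' - l22' - l31 - 1)
        * krawtchouk (l + l21 + l22) (l + l21' + l22') ((sin theta)\<^sup>2) (2 * l - n)
        * racah (l31 - l21) (l31 - l) (l32 - l31 - 1) (l21 + l22 + l33 - 1)
            (n + l21 + l22 - l31 - 1) (- l21 - l22 - l31 - 1)
        * krawtchouk (l11 - l22) (n + l21) ((sin chi)\<^sup>2) (l21 - l22)
    = zrot phi (a', b', c') (a', b', y') * weyl (a', b', y') (\<alpha>, \<beta>, y')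
        * zrot (- theta) (\<alpha>, \<beta>, y') (\<alpha>, \<beta>, y)
        * (weyl (\<alpha>, \<beta>, y) (a, b, y) * zrot chi (a, b, y) (a, b, c))"
proof -
  have r3: "r + r + r = of_int p + of_int P - 1" using r by simp
  have y: "y = a + b + \<alpha> + \<beta> - p - P - 1" and y': "y' = a' + b' + \<alpha> + \<beta> - p - P - 1"
    by (simp_all add: y_def y'_def third_index_def)
  have n1: "n + l21' = of_int (b' - 1 - y')" "n + l21 = of_int (b - 1 - y)" "- n - l22 = of_int (y - a)"
    "n + l11' + l21' - l22' = of_int ((b' - 1 - y') + (b' - 1 - c'))"
    "n + l11 + l21 - l22 = of_int ((b - 1 - c) + (b - 1 - y))"
    and k: "l11' - l22' = of_int (b' - 1 - c')" "l21' - l22' = of_int (b' - 1 - a')"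
      "l11 - l22 = of_int (b - 1 - c)" "l21 - l22 = of_int (b - 1 - a)" "l21' - l11' = of_int (c' - a')"
      "l31 - l21' = of_int a'" "l31 - l = of_int \<alpha>" "l31 - l21 = of_int a"
    and l1: "2 * l - n = of_int (\<beta> - 1 - \<alpha>)" "l + l21 + l22 = of_int (\<beta> - 1 - y)"
      "l + l21' + l22' = of_int (\<beta> - 1 - y')" "l - n - l21' - l22' = of_int (y' - \<alpha>)"
      "2 * l + l21' + l22' + l21 + l22 = of_int ((\<beta> - 1 - y) + (\<beta> - 1 - y'))"
      "l11' + l - n = of_int (\<beta> - 1 - c')"
    using r3 by (simp_all add: L y y')
  have t1: "t_coeff lam l21' (n + l21' + l22') l22' = weyl_scale (a', b', y') * ifac y'"
    and t2: "t_coeff lam l (n + l21 + l22) (n - l) = weyl_scale (\<alpha>, \<beta>, y) * ifac y"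
    using r3 by (intro t_coeff_lam; simp add: L y y')+
  define R' R where "R' = racah (l31 - l21') (l31 - l) (l32 - l31 - 1) (l21' + l22' + l33 - 1)
            (n + l21' + l22' - l31 - 1) (- l21' - l22' - l31 - 1)"
    and "R = racah (l31 - l21) (l31 - l) (l32 - l31 - 1) (l21 + l22 + l33 - 1)
            (n + l21 + l22 - l31 - 1) (- l21 - l22 - l31 - 1)"
  have R': "R' * ifac y' = racah_sum \<alpha> \<beta> a' b' y'"
    unfolding R'_def k using r3 by (intro racah_eq_racah_sum pats; simp add: L y')
  have R: "R * ifac y = racah_sum \<alpha> \<beta> a b y"
    unfolding R_def k using r3 by (intro racah_eq_racah_sum pats; simp add: L y)
  have w': "weyl (a', b', y') (\<alpha>, \<beta>, y') = (- 1) ^ nat (\<beta> + b') * (weyl_scale (a', b', y') * (R' * ifac y'))"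
    unfolding R' by (intro weyl_entry pats) (simp add: y')
  have w: "weyl (\<alpha>, \<beta>, y) (a, b, y) = (- 1) ^ nat (b + \<beta>) * (weyl_scale (\<alpha>, \<beta>, y) * (R * ifac y))"
    unfolding R racah_sum_commute[of \<alpha> \<beta>] by (intro weyl_entry pats) (simp add: y)
  have nn: "0 \<le> b' - 1 - c'" "0 \<le> \<beta> + b'" "0 \<le> \<beta> - 1 - y" "0 \<le> b + \<beta>" "0 \<le> b - 1 - y"
    "0 \<le> b' - 1 - a'" "0 \<le> \<beta> - 1 - \<alpha>" "0 \<le> b - 1 - a" "0 \<le> (b' - 1 - y') + (b' - 1 - c')"
    "0 \<le> (\<beta> - 1 - y) + (\<beta> - 1 - y')" "0 \<le> (b - 1 - c) + (b - 1 - y)"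
    using pats p_nonneg by auto
  \<comment> \<open>One sign comes from each of the five factors; the exponents add up to \<beta> -
    1 - c' plus an even number. As \<beta> - 1 - c' may be negative, the computation uses integer
    powers.\<close>
  have sgn: "ipow (- 1) (of_int (\<beta> - 1 - c')) = (- 1) ^ nat (b' - 1 - c') * (- 1) ^ nat (\<beta> + b')
      * (- 1) ^ nat (\<beta> - 1 - y) * (- 1) ^ nat (b + \<beta>) * ((- 1) ^ nat (b - 1 - y) :: real)"
  proof -
    have pn: "(- 1 :: real) ^ nat k = (- 1) powi k" if "0 \<le> k" for k
      using that by (simp add: power_int_def)
    have pa: "(- 1 :: real) powi (i + j) = (- 1) powi i * (- 1) powi j" for i j
      by (simp add: power_int_add)
    have "(- 1) ^ nat (b' - 1 - c') * (- 1) ^ nat (\<beta> + b')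
      * (- 1) ^ nat (\<beta> - 1 - y) * (- 1) ^ nat (b + \<beta>) * ((- 1) ^ nat (b - 1 - y) :: real)
      = (- 1) powi ((b' - 1 - c') + (\<beta> + b') + (\<beta> - 1 - y) + (b + \<beta>) + (b - 1 - y))"
      by (simp only: pn[OF nn(1)] pn[OF nn(2)] pn[OF nn(3)] pn[OF nn(4)] pn[OF nn(5)] pa mult.assoc)
    also have "(b' - 1 - c') + (\<beta> + b') + (\<beta> - 1 - y) + (b + \<beta>) + (b - 1 - y) = (\<beta> - 1 - c') + 2 * (b' + \<beta> + b - y - 1)"
      by simp
    also have "(- 1 :: real) powi \<dots> = (- 1) powi (\<beta> - 1 - c')"
      unfolding pa[of "\<beta> - 1 - c'"] by (simp add: power_int_mult)
    finally show ?thesis by (simp add: ipow_def)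
  qed
  show ?thesis
    unfolding \<mu>_def Let_def prod.case t1 t2 R'_def[symmetric] R_def[symmetric]
    unfolding n1 k l1 ifact_of_int sgn
      ipow_of_int[OF nn(6)] ipow_of_int[OF nn(7)] ipow_of_int[OF nn(8)] ipow_of_int[OF nn(9)]
      ipow_of_int[OF nn(10)] ipow_of_int[OF nn(11)] w w'
      zrot_entry[OF pats(2) pats(4) gen(5,6)] zrot_entry[OF pats(3) pats(1) gen(1,2)]
      zrot_minus_entry[OF pats(6) pats(5) gen(3,4)]
    by (simp only: times_divide_eq_left times_divide_eq_right divide_divide_eq_left mult_ac mult_1_left)
qed

lemma max_of_int_add: "max (real_of_int u + x) (real_of_int v + x) = real_of_int (max u v) + x"
  by (simp add: max_def)

lemma min_of_int_add: "min (real_of_int u + x) (real_of_int v + x) = real_of_int (min u v) + x"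
  by (simp add: min_def)

lemma matrix_element_sum_eq:
  assumes pats: "(a', b', c') \<in> pats" "(a, b, c) \<in> pats"
    and gen: "(chi, theta, phi) \<in> generic_angles"
  shows "matrix_element_sum lam (pat (a', b', c')) (pat (a, b, c)) (chi, theta, phi)
    = (zrot phi \<star> yrot theta \<star> zrot chi) (a', b', c') (a, b, c)"
proof -
  define f where "f = (\<lambda>(\<alpha>, \<beta>). zrot phi (a', b', c') (a', b', third_index a' b' \<alpha> \<beta>)
        * weyl (a', b', third_index a' b' \<alpha> \<beta>) (\<alpha>, \<beta>, third_index a' b' \<alpha> \<beta>)
        * zrot (- theta) (\<alpha>, \<beta>, third_index a' b' \<alpha> \<beta>) (\<alpha>, \<beta>, third_index a b \<alpha> \<beta>)
        * (weyl (\<alpha>, \<beta>, third_index a b \<alpha> \<beta>) (a, b, third_index a b \<alpha> \<beta>) * zrot chi (a, b, third_index a b \<alpha> \<beta>) (a, b, c)))"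
  define J where "J = {(\<alpha>, \<beta>) \<in> {0..p} \<times> {p + 1..P}. (a, b, third_index a b \<alpha> \<beta>) \<in> pats \<and> (\<alpha>, \<beta>, third_index a b \<alpha> \<beta>) \<in> pats
     \<and> (a', b', third_index a' b' \<alpha> \<beta>) \<in> pats \<and> (\<alpha>, \<beta>, third_index a' b' \<alpha> \<beta>) \<in> pats}"
  have r3: "r + r + r = of_int p + of_int P - 1" using r by simp
  have g: "sin chi \<noteq> 0" "cos chi \<noteq> 0" "sin theta \<noteq> 0" "cos theta \<noteq> 0" "sin phi \<noteq> 0" "cos phi \<noteq> 0"
    using gen by (auto simp: generic_angles_def)
  define lo where "lo = (\<lambda>\<nu>. max (- p) (max (\<nu> + 1 - P) (max (a + b - p - P) (max (\<nu> + 1 - a - b)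
       (max (a' + b' - p - P) (\<nu> + 1 - a' - b'))))))"
  \<comment> \<open>The summation bounds are the interlacing conditions. The range of \<nu> says
    that the third codes fit between a and b and between a' and b'; the range of k says that
    (\<alpha>, \<beta>) is admissible and that both third codes fit between \<alpha> and
    \<beta>.\<close>
  have mem_J: "\<nu> \<in> {max a a'..min (b - 1) (b' - 1)} \<and> k \<in> {lo \<nu>..min 0 (\<nu> - p)} \<longleftrightarrow> (- k, p + P + k - \<nu>) \<in> J" for \<nu> k
    using pats unfolding J_def lo_def third_index_def atLeastAtMost_iff max.bounded_iff min.bounded_iff mem_Collect_eq prod.case mem_Times_iff fst_conv snd_conv mem_pats
    by (elim conjE, intro iffI; elim conjE; intro conjI; linarith)
  have mem_J': "p + P - \<alpha> - \<beta> \<in> {max a a'..min (b - 1) (b' - 1)} \<and> - \<alpha> \<in> {lo (p + P - \<alpha> - \<beta>)..min 0 (p + P - \<alpha> - \<beta> - p)}"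
    if "(\<alpha>, \<beta>) \<in> J" for \<alpha> \<beta>
    using mem_J[of "p + P - \<alpha> - \<beta>" "- \<alpha>"] that by simp
  have n_lo: "max (- (r - of_int a)) (- (r - of_int a')) = of_int (max a a') + (- r)"
    and n_hi: "min (- (r + 1 - of_int b)) (- (r + 1 - of_int b')) = of_int (min (b - 1) (b' - 1)) + (- r)"
    by (auto simp: max_def min_def)
  have l_lo: "Max {r - of_int p, of_int \<nu> + - r - (r - of_int p), - (r - of_int a) - (r + 1 - of_int b),
      of_int \<nu> + - r + (r - of_int a) + (r + 1 - of_int b), - (r - of_int a') - (r + 1 - of_int b'),
      of_int \<nu> + - r + (r - of_int a') + (r + 1 - of_int b')} = of_int (lo \<nu>) + r" for \<nu>
  proof -
    have "r - of_int p = of_int (- p) + r" "of_int \<nu> + - r - (r - of_int p) = of_int (\<nu> + 1 - P) + r"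
      "- (r - of_int a) - (r + 1 - of_int b) = of_int (a + b - p - P) + r"
      "of_int \<nu> + - r + (r - of_int a) + (r + 1 - of_int b) = of_int (\<nu> + 1 - a - b) + r"
      "- (r - of_int a') - (r + 1 - of_int b') = of_int (a' + b' - p - P) + r"
      "of_int \<nu> + - r + (r - of_int a') + (r + 1 - of_int b') = of_int (\<nu> + 1 - a' - b') + r"
      using r3 by simp_all
    then show ?thesis by (simp only: Max_insert Max_singleton finite.intros insert_not_empty not_False_eq_True max_of_int_add lo_def)
  qed
  have l_hi: "min r (of_int \<nu> + - r - (r + 1 - of_int P)) = of_int (min 0 (\<nu> - p)) + r" for \<nu>
  proof -
    have "of_int \<nu> + - r - (r + 1 - of_int P) = of_int (\<nu> - p) + r" "r = of_int 0 + r" using r3 by simp_all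
    then show ?thesis by (metis min_of_int_add)
  qed
  have "matrix_element_sum lam (pat (a', b', c')) (pat (a, b, c)) (chi, theta, phi)
     = (\<Sum>\<nu>\<in>{max a a'..min (b - 1) (b' - 1)}. \<Sum>\<mu>\<in>{lo \<nu>..min 0 (\<nu> - p)}. f (- \<mu>, p + P + \<mu> - \<nu>))"
    unfolding matrix_element_sum_def lam_def pat_def Let_def prod.case n_lo n_hi sum_unit_steps_of_int l_lo l_hi
  proof (intro sum.cong)
    fix \<nu> k assume \<nu>: "\<nu> \<in> {max a a'..min (b - 1) (b' - 1)}" and k: "k \<in> {lo \<nu>..min 0 (\<nu> - p)}"
    have J: "(a, b, third_index a b (- k) (p + P + k - \<nu>)) \<in> pats" "(- k, p + P + k - \<nu>, third_index a b (- k) (p + P + k - \<nu>)) \<in> pats"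
       "(a', b', third_index a' b' (- k) (p + P + k - \<nu>)) \<in> pats" "(- k, p + P + k - \<nu>, third_index a' b' (- k) (p + P + k - \<nu>)) \<in> pats"
      using mem_J[of \<nu> k] \<nu> k by (simp_all add: J_def del: mem_pats)
    show "\<mu> (r, r - of_int p, r + 1 - of_int P) (r - of_int c', r - of_int a', r + 1 - of_int b')
            (r - of_int c, r - of_int a, r + 1 - of_int b) (chi, theta, phi) (of_int k + r) (of_int \<nu> + - r)
        * krawtchouk (of_int \<nu> + - r + (r - of_int a')) (r - of_int c' - (r + 1 - of_int b')) ((sin phi)\<^sup>2) (r - of_int a' - (r + 1 - of_int b'))
        * racah (r - (r - of_int a')) (r - (of_int k + r)) (r - of_int p - r - 1) (r - of_int a' + (r + 1 - of_int b') + (r + 1 - of_int P) - 1)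
            (of_int \<nu> + - r + (r - of_int a') + (r + 1 - of_int b') - r - 1) (- (r - of_int a') - (r + 1 - of_int b') - r - 1)
        * krawtchouk (of_int k + r + (r - of_int a) + (r + 1 - of_int b)) (of_int k + r + (r - of_int a') + (r + 1 - of_int b')) ((sin theta)\<^sup>2) (2 * (of_int k + r) - (of_int \<nu> + - r))
        * racah (r - (r - of_int a)) (r - (of_int k + r)) (r - of_int p - r - 1) (r - of_int a + (r + 1 - of_int b) + (r + 1 - of_int P) - 1)
            (of_int \<nu> + - r + (r - of_int a) + (r + 1 - of_int b) - r - 1) (- (r - of_int a) - (r + 1 - of_int b) - r - 1)
        * krawtchouk (r - of_int c - (r + 1 - of_int b)) (of_int \<nu> + - r + (r - of_int a)) ((sin chi)\<^sup>2) (r - of_int a - (r + 1 - of_int b))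
       = f (- k, p + P + k - \<nu>)"
      unfolding f_def prod.case lam_def[symmetric]
      by (rule summand_eq[OF pats(2,1) J(1) J(3) J(2) J(4)]) (simp_all add: g lam_def)
  qed simp_all
  also have "\<dots> = (\<Sum>(\<nu>, k)\<in>(SIGMA \<nu>:{max a a'..min (b - 1) (b' - 1)}. {lo \<nu>..min 0 (\<nu> - p)}). f (- k, p + P + k - \<nu>))"
    by (simp add: sum.Sigma)
  also have "\<dots> = sum f J"
    by (rule sum.reindex_bij_witness[where i = "\<lambda>(\<alpha>, \<beta>). (p + P - \<alpha> - \<beta>, - \<alpha>)" and j = "\<lambda>(\<nu>, k). (- k, p + P + k - \<nu>)"])
      (use mem_J mem_J' in \<open>auto simp: mem_Sigma_iff simp del: atLeastAtMost_iff\<close>)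
  also have "\<dots> = sum f ({0..p} \<times> {p + 1..P})"
  proof (rule sum.mono_neutral_left)
    \<comment> \<open>Outside \<open>J\<close> an index of one of the two \<open>weyl\<close>
      entries is not a pattern, so that entry is zero.\<close>
    show "\<forall>j\<in>{0..p} \<times> {p + 1..P} - J. f j = 0"
      using supportedD[OF supported_weyl] by (fastforce simp: f_def J_def simp del: mem_pats)
  qed (auto simp: J_def)
  also have "\<dots> = (zrot phi \<star> yrot theta \<star> zrot chi) (a', b', c') (a, b, c)"
    unfolding yrot_def product_entry[OF pats] f_def ..
  finally show ?thesis .
qed

section \<open>Continuity in the angles\<close>

lemma continuous_zrot: "isCont (\<lambda>t. zrot t i j) t"
  using zrot_deriv DERIV_isCont by blast

lemma continuous_yrot: "isCont (\<lambda>t. yrot t i j) t"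
  using yrot_deriv DERIV_isCont by blast

lemma tendsto_product:
  "((\<lambda>(chi, theta, phi). (zrot phi \<star> yrot theta \<star> zrot chi) i j) \<longlongrightarrow> (zrot phi \<star> yrot theta \<star> zrot chi) i j)
     (at (chi, theta, phi) within A)"
proof -
  have z: "((\<lambda>x. zrot (snd (snd x)) k l) \<longlongrightarrow> zrot phi k l) (at (chi, theta, phi) within A)"
    and y: "((\<lambda>x. yrot (fst (snd x)) k l) \<longlongrightarrow> yrot theta k l) (at (chi, theta, phi) within A)"
    and x: "((\<lambda>x. zrot (fst x) k l) \<longlongrightarrow> zrot chi k l) (at (chi, theta, phi) within A)" for k l
    using tendsto_ident_at[of "(chi, theta, phi)" A]
    by (auto intro!: isCont_tendsto_compose[OF continuous_zrot] isCont_tendsto_compose[OF continuous_yrot]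
        tendsto_eq_intros)
  show ?thesis
    unfolding mm_def case_prod_beta by (intro tendsto_sum tendsto_mult x y z)
qed

end

theorem theorem6p1:
  fixes lam L L' :: triple
    and chi theta phi :: real
    and rep :: "complex^3^3 \<Rightarrow> gt_vector \<Rightarrow> gt_vector"
    and S :: "real^3^3"
    and \<sigma> :: "gt_vector \<Rightarrow> gt_vector"
    and s :: "triple \<Rightarrow> triple \<Rightarrow> complex"
  assumes "highest_weight lam"
    and "integrates_sl3_action lam rep"
    and "S = Rz chi ** Ry theta ** Rz phi"
    and "\<sigma> = rep (matrix_inv (complex_matrix S))"
    and "\<And>K. K \<in> gt_patterns lam \<Longrightarrow>
           \<sigma> (\<xi> lam K) = (\<lambda>M. \<Sum>K'\<in>gt_patterns lam. s K' K * \<xi> lam K' M)"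
    and "L \<in> gt_patterns lam"
    and "L' \<in> gt_patterns lam"
  shows "((chi, theta, phi) \<in> generic_angles \<longrightarrow>
            s L' L = of_real (matrix_element_sum lam L' L (chi, theta, phi))) \<and>
         ((\<lambda>a. complex_of_real (matrix_element_sum lam L' L a)) \<longlongrightarrow> s L' L)
            (at (chi, theta, phi) within generic_angles)"
proof -
  obtain l31 l32 l33 where lam: "lam = (l31, l32, l33)" by (cases lam) auto
  have sum0: "l31 + l32 + l33 = 0" using assms(1) by (simp add: lam)
  obtain m k where m: "l31 - l32 = of_nat m" and k: "l32 - l33 = of_nat k"
    using assms(1) unfolding lam by (auto elim!: Nats_cases)
  define p P where "p = int m" and "P = int m + int k + 1"
  interpret gt: gt_module p P l31
    using m k sum0 by unfold_locales (simp_all add: p_def P_def)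
  have lam': "lam = gt.lam"
    unfolding gt.lam_def lam using m k by (simp add: p_def P_def)
  obtain i j where j: "L = gt.pat j" "j \<in> gt.pats" and i: "L' = gt.pat i" "i \<in> gt.pats"
    using assms(6,7) unfolding lam' gt.pat_image by auto
  define f :: "triple \<Rightarrow> real" where
    "f = (\<lambda>(chi, theta, phi). gt.mm (gt.mm (gt.zrot phi) (gt.yrot theta)) (gt.zrot chi) i j)"
  have rep: "integrates_sl3_action gt.lam rep" using assms(2) unfolding lam' .
  \<comment> \<open>The coefficient is the coordinate at \<open>L'\<close> of the image vector,
    because distinct basis vectors have disjoint supports.\<close>
  have "s L' L = (\<Sum>K'\<in>gt_patterns lam. if K' = L' then s K' L else 0)"
    using assms(7) gt.finite_gt_patterns unfolding lam' by simp
  also have "\<dots> = (\<Sum>K'\<in>gt_patterns lam. s K' L * \<xi> lam K' L')"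
  proof (rule sum.cong)
    fix K' assume "K' \<in> gt_patterns lam"
    then show "(if K' = L' then s K' L else 0) = s K' L * \<xi> lam K' L'"
      by (cases "K' = L'") (simp_all add: \<xi>_def)
  qed simp
  also have "\<dots> = \<sigma> (\<xi> lam L) L'"
    using assms(5)[OF assms(6)] by simp
  also have "\<dots> = of_real (f (chi, theta, phi))"
    using gt.rmat_rotation[OF rep i(2) j(2), of chi theta phi]
    unfolding gt.rmat_def[OF rep] assms(3,4) lam' i(1) j(1) f_def by simp
  finally have s: "s L' L = of_real (f (chi, theta, phi))" .
  have eq: "matrix_element_sum lam L' L x = f x" if "x \<in> generic_angles" for x
    using that i j by (cases x; cases i; cases j) (simp add: lam' f_def gt.matrix_element_sum_eq del: gt.mem_pats)
  have "(f \<longlongrightarrow> f (chi, theta, phi)) (at (chi, theta, phi) within generic_angles)"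
    using gt.tendsto_product unfolding f_def by simp
  then have "((\<lambda>x. complex_of_real (f x)) \<longlongrightarrow> s L' L) (at (chi, theta, phi) within generic_angles)"
    unfolding s by (rule tendsto_of_real)
  moreover have "\<forall>\<^sub>F x in at (chi, theta, phi) within generic_angles.
      complex_of_real (f x) = complex_of_real (matrix_element_sum lam L' L x)"
    using eq by (simp add: eventually_at_filter)
  ultimately have "((\<lambda>x. complex_of_real (matrix_element_sum lam L' L x)) \<longlongrightarrow> s L' L)
      (at (chi, theta, phi) within generic_angles)"
    by (rule Lim_transform_eventually)
  then show ?thesis using s eq by auto
qed

end
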